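(* Let $\Phi:\mathbb{R}\times\mathbb{R}^N\to\mathbb{R}^N$ be a flow generated by a normalizable vector field, let $\bar\Phi:\mathbb{R}\times B_N\to B_N$ be its Poincaré compactification (which includes a time change), and let $U$ be a sufficiently small neighborhood of infinity in $\mathbb{R}^N$. 1) Suppose that $\bar\Phi$ satisfies the Main Assumption for flows with Item 4.a), with $\mu_2<0$ and $\Lambda=\partial B_N$. Let $m$ be such that $e^{\mu_2 m}<e^{\lambda^{s}_{min}}$, i.e. $m>\lambda^{s}_{min}/\mu_2$. Then $\Phi$ has the noncompact nonuniform oriented shadowing property in $U$ with exponent $3-2m$. 2) Suppose that $\bar\Phi$ satisfies the Main Assumption for flows with Item 4.b), with $\mu_2<0$ and $\Lambda=\partial B_N$. Let $m\ge 0$ be such that $e^{\mu_1 m}>e^{\lambda^{s}_{max}}$, i.e. $m<\lambda^{s}_{max}/\mu_1$. Then $\Phi$ has the noncompact nonuniform oriented shadowing property in $U$ with exponent $3-2m$.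
   Context: **Poincaré compactification.** $B_N$ is the closed unit ball in $\mathbb{R}^N$, $\partial B_N$ its boundary sphere, and $\Theta:\mathbb{R}^N\to B_N\setminus\partial B_N$, $\Theta(x)=x/\sqrt{|x|^2+1}$. A vector field on $\mathbb{R}^N$ is normalizable if, after being transported by $\Theta$ to $B_N\setminus\partial B_N$ and after a suitable time change, it extends to a vector field on all of $B_N$ (polynomial vector fields are normalizable); the flow $\bar\Phi$ of the extended vector field on $B_N$ is the compactified flow. **Time change.** $Rep$ is the class of increasing homeomorphisms of $\mathbb{R}$. A time change for $\Phi$ is a map $\alpha:\mathbb{R}\times\mathbb{R}^N\to\mathbb{R}$ such that $\alpha(\cdot,x)\in Rep$, $\alpha(0,x)=0$ for every $x$, and $(t,x)\mapsto\Phi(\alpha(t,x),x)$ is a flow. The time change $\alpha$ inverse to that of the compactification satisfies $\Theta(\Phi(\alpha(t,x),x))=\bar\Phi(t,\Theta(x))$. **Noncompact nonuniform oriented shadowing in $U$ with exponent $3-2m$.** There is a time change $\alpha$ such that for every $\Delta>0$, with $\epsilon(z)=\Delta|z|^{3-2m}$, there exist numbers $\delta_0>0$ and $n_0$ such that the following holds. For every function $d(z)=\delta|z|^{-n}$ with $\delta\le\delta_0$, $n\ge n_0$, and every (not necessarily continuous) $\Psi:\mathbb{R}\to\mathbb{R}^N$ with $\Psi(t)\in U$ for $t\ge0$ and $$\max_{|\tau|\le1}|\Psi(t+\tau)-\Phi(\alpha(\tau,\Psi(t)),\Psi(t))|\le\min_{|\tau|\le1}d\big(|\Phi(\alpha(\tau,\Psi(t)),\Psi(t))|\big)\quad\text{for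 all }t>0,$$ there exists $q\in\mathbb{R}^N$ such that $$|\Psi(t)-\Phi(\alpha(t,q),q)|\le\max_{\alpha([t],q)\le\tau\le\alpha([t]+1,q)}\epsilon(|\Phi(\tau,q)|)\quad\text{for all }t\ge0,$$ where $[t]$ is the largest integer not exceeding $t$. **Main Assumption for flows** (for a flow $\Phi$ on a compact smooth manifold $M$ with boundary; applied here to $\bar\Phi$ on $M=B_N$). $D\Phi(t,p)$ is the derivative of $x\mapsto\Phi(t,x)$ at $p$. There is a compact locally maximal invariant set $\Lambda\subset\partial M$ such that for every $p\in\Lambda$ there is a one-dimensional subspace $\ell(p)\subset T_pM$ such that, for some constants $\mu_1\le\mu_2$ and some sufficiently large constant $C_0$: 0) $\ell(p)\not\subset T_p\partial M$; 1) $\ell(\Phi(t,p))=D\Phi(t,p)\ell(p)$ for all $t\in\mathbb{R}$; 2) $\ell(p)$ depends continuously on $p$; 3) $(e^{\mu_1t}/C_0)|v|\le|D\Phi(t,p)v|\le C_0e^{\mu_2t}|v|$ for all $v\in\ell(p)$, $t\ge0$; and one of the following: 4.a) (when $\mu_2<0$) $\lambda^s_{min}$ is a number such that $|D\Phi(t,p)v|\ge e^{\lambda^s_{min}t}|v|/C_0$ for all $v\in T_pM$, $t\ge0$; 4.b) $\Lambda$ is hyperbolic for $\Phi$: there are invariant subspaces $S(p),U(p)\subset T_pM$ such that $S(p)\oplus U(p)=T_pM$ if $p$ is a fixed point, and $S(p)\oplus U(p)$ has codimension 1 in $T_pM$ and is transversal to the vector field if $p$ is not a fixed point, and there are numbers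 $\lambda^s_{min}\le\lambda^s_{max}<0<\lambda^u_{min}\le\lambda^u_{max}$ such that for all $t\ge0$: $e^{\lambda^s_{min}t}|v|/C_0\le|D\Phi(t,p)v|\le C_0e^{\lambda^s_{max}t}|v|$ for $v\in S(p)$, and $e^{\lambda^u_{min}t}|v|/C_0\le|D\Phi(t,p)v|\le C_0e^{\lambda^u_{max}t}|v|$ for $v\in U(p)$. *)

theory Defs
  imports "HOL-Analysis.Analysis"
begin

section \<open>Vector fields and flows\<close>

text \<open>The set \<open>M\<close> is the whole space or the closed unit ball. On the ball, derivatives are
  taken within the ball, so a \<open>C\<^sup>1\<close> field is \<open>C\<^sup>1\<close> up to and including the boundary.\<close>

definition C1_vector_field_on :: "(real^'n) set \<Rightarrow> (real^'n \<Rightarrow> real^'n) \<Rightarrow> bool" where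
  "C1_vector_field_on M X \<longleftrightarrow>
     (\<exists>X' :: real^'n \<Rightarrow> (real^'n) \<Rightarrow>\<^sub>L (real^'n).
        (\<forall>x\<in>M. (X has_derivative blinfun_apply (X' x)) (at x within M)) \<and> continuous_on M X')"

definition flow_on :: "(real^'n) set \<Rightarrow> (real \<Rightarrow> real^'n \<Rightarrow> real^'n) \<Rightarrow> bool" where
  "flow_on M \<Phi> \<longleftrightarrow>
     continuous_on (UNIV \<times> M) (\<lambda>(t, x). \<Phi> t x) \<and>
     (\<forall>t. \<forall>x\<in>M. \<Phi> t x \<in> M) \<and>
     (\<forall>x\<in>M. \<Phi> 0 x = x) \<and>
     (\<forall>s t. \<forall>x\<in>M. \<Phi> (s + t) x = \<Phi> s (\<Phi> t x))"

definition generates_flow_on ::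
    "(real^'n) set \<Rightarrow> (real^'n \<Rightarrow> real^'n) \<Rightarrow> (real \<Rightarrow> real^'n \<Rightarrow> real^'n) \<Rightarrow> bool" where
  "generates_flow_on M X \<Phi> \<longleftrightarrow>
     C1_vector_field_on M X \<and> flow_on M \<Phi> \<and>
     (\<forall>x\<in>M. \<forall>t. ((\<lambda>s. \<Phi> s x) has_vector_derivative X (\<Phi> t x)) (at t))"

section \<open>Compactification\<close>

definition Theta :: "real^'n \<Rightarrow> real^'n" where
  "Theta x = (1 / sqrt ((norm x)\<^sup>2 + 1)) *\<^sub>R x"

text \<open>\<open>Y\<close> extends to the closed ball the push-forward of \<open>X\<close> under \<open>Theta\<close>, after the time
  change given by multiplication with a positive continuous function \<open>\<rho>\<close>.\<close>

definition compactified_field :: "(real^'n \<Rightarrow> real^'n) \<Rightarrow> (real^'n \<Rightarrow> real^'n) \<Rightarrow> bool" where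
  "compactified_field X Y \<longleftrightarrow>
     C1_vector_field_on (cball 0 1) Y \<and>
     (\<exists>\<rho> :: real^'n \<Rightarrow> real. continuous_on UNIV \<rho> \<and> (\<forall>x. \<rho> x > 0) \<and>
        (\<forall>x. Y (Theta x) = \<rho> x *\<^sub>R frechet_derivative Theta (at x) (X x)))"

definition normalizable :: "(real^'n \<Rightarrow> real^'n) \<Rightarrow> bool" where
  "normalizable X \<longleftrightarrow> (\<exists>Y. compactified_field X Y)"

definition compactified_flow ::
    "(real^'n \<Rightarrow> real^'n) \<Rightarrow> (real \<Rightarrow> real^'n \<Rightarrow> real^'n) \<Rightarrow> bool" where
  "compactified_flow X \<Phi>' \<longleftrightarrow>
     (\<exists>Y. compactified_field X Y \<and> generates_flow_on (cball 0 1) Y \<Phi>')"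

section \<open>Time changes and shadowing\<close>

definition Rep :: "(real \<Rightarrow> real) set" where
  "Rep = {f. strict_mono f \<and> (\<exists>g. homeomorphism UNIV UNIV f g)}"

definition time_change ::
    "(real \<Rightarrow> real^'n \<Rightarrow> real^'n) \<Rightarrow> (real \<Rightarrow> real^'n \<Rightarrow> real) \<Rightarrow> bool" where
  "time_change \<Phi> \<alpha> \<longleftrightarrow>
     (\<forall>x. (\<lambda>t. \<alpha> t x) \<in> Rep \<and> \<alpha> 0 x = 0) \<and> flow_on UNIV (\<lambda>t x. \<Phi> (\<alpha> t x) x)"

definition neighborhood_of_infinity :: "(real^'n) set \<Rightarrow> bool" where
  "neighborhood_of_infinity U \<longleftrightarrow> (\<forall>\<^sub>F x in at_infinity. x \<in> U)"

text \<open>The maxima and minima are taken in \<open>ereal\<close>: since \<open>\<Psi>\<close> may be discontinuous, the first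
  supremum need be neither attained nor finite, and a supremum in \<open>real\<close> would then be
  meaningless.\<close>

definition nonuniform_oriented_shadowing ::
    "(real \<Rightarrow> real^'n \<Rightarrow> real^'n) \<Rightarrow> (real^'n) set \<Rightarrow> real \<Rightarrow> bool" where
  "nonuniform_oriented_shadowing \<Phi> U e \<longleftrightarrow>
     (\<exists>\<alpha>. time_change \<Phi> \<alpha> \<and>
       (\<forall>\<Delta>>0. \<exists>\<delta>\<^sub>0>0. \<exists>n\<^sub>0::real. \<forall>\<delta> n. 0 < \<delta> \<and> \<delta> \<le> \<delta>\<^sub>0 \<and> n\<^sub>0 \<le> n \<longrightarrow>
         (\<forall>\<Psi> :: real \<Rightarrow> real^'n.
            (\<forall>t\<ge>0. \<Psi> t \<in> U) \<and>
            (\<forall>t>0. (SUP \<tau>\<in>{-1..1}. ereal (norm (\<Psi> (t + \<tau>) - \<Phi> (\<alpha> \<tau> (\<Psi> t)) (\<Psi> t))))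
                   \<le> (INF \<tau>\<in>{-1..1}. ereal (\<delta> * norm (\<Phi> (\<alpha> \<tau> (\<Psi> t)) (\<Psi> t)) powr (- n))))
            \<longrightarrow>
            (\<exists>q. \<forall>t\<ge>0.
               ereal (norm (\<Psi> t - \<Phi> (\<alpha> t q) q))
               \<le> (SUP \<tau>\<in>{\<alpha> (of_int \<lfloor>t\<rfloor>) q..\<alpha> (of_int \<lfloor>t\<rfloor> + 1) q}.
                     ereal (\<Delta> * norm (\<Phi> \<tau> q) powr e))))))"

section \<open>The Main Assumption on the closed unit ball\<close>

text \<open>Here \<open>M\<close> is \<open>cball 0 1\<close>, so every tangent space of \<open>M\<close>, also at a boundary point, is the
  whole of \<open>real^'n\<close>.\<close>

definition tangent_boundary :: "real^'n \<Rightarrow> (real^'n) set" where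
  "tangent_boundary p = {v. v \<bullet> p = 0}"

definition flow_derivative ::
    "(real \<Rightarrow> real^'n \<Rightarrow> real^'n) \<Rightarrow> real \<Rightarrow> real^'n \<Rightarrow> real^'n \<Rightarrow> real^'n" where
  "flow_derivative \<Phi> t p = frechet_derivative (\<Phi> t) (at p within cball 0 1)"

definition C1_flow_on_ball :: "(real \<Rightarrow> real^'n \<Rightarrow> real^'n) \<Rightarrow> bool" where
  "C1_flow_on_ball \<Phi> \<longleftrightarrow>
     flow_on (cball 0 1) \<Phi> \<and>
     (\<forall>t. \<forall>p\<in>cball 0 1. \<Phi> t differentiable (at p within cball 0 1)) \<and>
     (\<forall>v. continuous_on (UNIV \<times> cball 0 1) (\<lambda>(t, p). flow_derivative \<Phi> t p v))"

definition locally_maximal_invariant ::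
    "(real \<Rightarrow> real^'n \<Rightarrow> real^'n) \<Rightarrow> (real^'n) set \<Rightarrow> bool" where
  "locally_maximal_invariant \<Phi> \<Lambda> \<longleftrightarrow>
     (\<forall>t. \<Phi> t ` \<Lambda> = \<Lambda>) \<and>
     (\<exists>V. openin (top_of_set (cball 0 1)) V \<and> \<Lambda> \<subseteq> V \<and> \<Lambda> = (\<Inter>t. \<Phi> t ` V))"

text \<open>Continuity of a family of lines means that it is locally spanned by continuous
  nonvanishing vector fields.\<close>

definition continuous_line_field :: "(real^'n) set \<Rightarrow> (real^'n \<Rightarrow> (real^'n) set) \<Rightarrow> bool" where
  "continuous_line_field \<Lambda> L \<longleftrightarrow>
     (\<forall>p\<in>\<Lambda>. \<exists>W v. openin (top_of_set \<Lambda>) W \<and> p \<in> W \<and> continuous_on W v \<and>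
        (\<forall>q\<in>W. v q \<noteq> 0 \<and> L q = span {v q}))"

text \<open>\<open>C1_flow_on_ball\<close> makes \<open>flow_derivative\<close> meaningful; it is no restriction for a flow
  generated by a \<open>C\<^sup>1\<close> field on the ball. The numbers \<open>lsmin\<close>, \<open>lsmax\<close>, \<open>lumin\<close>, \<open>lumax\<close>
  below are \<open>\<lambda>\<close> with superscript \<open>s\<close> or \<open>u\<close> and subscript min or max.\<close>

definition main_assumption_0_3 ::
    "(real \<Rightarrow> real^'n \<Rightarrow> real^'n) \<Rightarrow> (real^'n) set \<Rightarrow> (real^'n \<Rightarrow> (real^'n) set)
      \<Rightarrow> real \<Rightarrow> real \<Rightarrow> real \<Rightarrow> bool" where
  "main_assumption_0_3 \<Phi> \<Lambda> L \<mu>\<^sub>1 \<mu>\<^sub>2 C\<^sub>0 \<longleftrightarrow>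
     C1_flow_on_ball \<Phi> \<and>
     compact \<Lambda> \<and> \<Lambda> \<subseteq> sphere 0 1 \<and> locally_maximal_invariant \<Phi> \<Lambda> \<and>
     C\<^sub>0 > 0 \<and> \<mu>\<^sub>1 \<le> \<mu>\<^sub>2 \<and>
     (\<forall>p\<in>\<Lambda>. subspace (L p) \<and> dim (L p) = 1) \<and>
     (\<forall>p\<in>\<Lambda>. \<not> L p \<subseteq> tangent_boundary p) \<and>
     (\<forall>p\<in>\<Lambda>. \<forall>t. L (\<Phi> t p) = flow_derivative \<Phi> t p ` L p) \<and>
     continuous_line_field \<Lambda> L \<and>
     (\<forall>p\<in>\<Lambda>. \<forall>v\<in>L p. \<forall>t\<ge>0.
        exp (\<mu>\<^sub>1 * t) / C\<^sub>0 * norm v \<le> norm (flow_derivative \<Phi> t p v) \<and>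
        norm (flow_derivative \<Phi> t p v) \<le> C\<^sub>0 * exp (\<mu>\<^sub>2 * t) * norm v)"

definition main_assumption_4a ::
    "(real \<Rightarrow> real^'n \<Rightarrow> real^'n) \<Rightarrow> (real^'n) set \<Rightarrow> real \<Rightarrow> real \<Rightarrow> real \<Rightarrow> bool" where
  "main_assumption_4a \<Phi> \<Lambda> \<mu>\<^sub>1 \<mu>\<^sub>2 lsmin \<longleftrightarrow>
     (\<exists>L C\<^sub>0. main_assumption_0_3 \<Phi> \<Lambda> L \<mu>\<^sub>1 \<mu>\<^sub>2 C\<^sub>0 \<and> \<mu>\<^sub>2 < 0 \<and>
        (\<forall>p\<in>\<Lambda>. \<forall>v. \<forall>t\<ge>0.
           norm (flow_derivative \<Phi> t p v) \<ge> exp (lsmin * t) * norm v / C\<^sub>0))"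

definition hyperbolic_for ::
    "(real \<Rightarrow> real^'n \<Rightarrow> real^'n) \<Rightarrow> (real^'n) set \<Rightarrow> real
      \<Rightarrow> real \<Rightarrow> real \<Rightarrow> real \<Rightarrow> real \<Rightarrow> bool" where
  "hyperbolic_for \<Phi> \<Lambda> C\<^sub>0 lsmin lsmax lumin lumax \<longleftrightarrow>
     lsmin \<le> lsmax \<and> lsmax < 0 \<and> 0 < lumin \<and> lumin \<le> lumax \<and>
     (\<exists>S U :: real^'n \<Rightarrow> (real^'n) set. \<forall>p\<in>\<Lambda>.
        subspace (S p) \<and> subspace (U p) \<and>
        (\<forall>t. flow_derivative \<Phi> t p ` S p = S (\<Phi> t p) \<and>
             flow_derivative \<Phi> t p ` U p = U (\<Phi> t p)) \<and>
        S p \<inter> U p = {0} \<and>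
        (if \<forall>t. \<Phi> t p = p
         then {x + y | x y. x \<in> S p \<and> y \<in> U p} = UNIV
         else dim {x + y | x y. x \<in> S p \<and> y \<in> U p} + 1 = CARD('n) \<and>
              vector_derivative (\<lambda>t. \<Phi> t p) (at 0) \<notin> {x + y | x y. x \<in> S p \<and> y \<in> U p}) \<and>
        (\<forall>v\<in>S p. \<forall>t\<ge>0.
           exp (lsmin * t) * norm v / C\<^sub>0 \<le> norm (flow_derivative \<Phi> t p v) \<and>
           norm (flow_derivative \<Phi> t p v) \<le> C\<^sub>0 * exp (lsmax * t) * norm v) \<and>
        (\<forall>v\<in>U p. \<forall>t\<ge>0.
           exp (lumin * t) * norm v / C\<^sub>0 \<le> norm (flow_derivative \<Phi> t p v) \<and>
           norm (flow_derivative \<Phi> t p v) \<le> C\<^sub>0 * exp (lumax * t) * norm v))"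

definition main_assumption_4b ::
    "(real \<Rightarrow> real^'n \<Rightarrow> real^'n) \<Rightarrow> (real^'n) set \<Rightarrow> real \<Rightarrow> real
      \<Rightarrow> real \<Rightarrow> real \<Rightarrow> real \<Rightarrow> real \<Rightarrow> bool" where
  "main_assumption_4b \<Phi> \<Lambda> \<mu>\<^sub>1 \<mu>\<^sub>2 lsmin lsmax lumin lumax \<longleftrightarrow>
     (\<exists>L C\<^sub>0. main_assumption_0_3 \<Phi> \<Lambda> L \<mu>\<^sub>1 \<mu>\<^sub>2 C\<^sub>0 \<and>
        hyperbolic_for \<Phi> \<Lambda> C\<^sub>0 lsmin lsmax lumin lumax)"

end

theory Submission
  imports Defs
begin

text \<open>The sphere at infinity attracts exponentially fast, while the size of the jumps allowed in a
pseudotrajectory is a power of the distance to the sphere whose exponent may be chosen as large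
as desired, after everything else. So along a pseudotrajectory near infinity the errors decay
like \<open>(\<theta>\<^sup>k)\<^sup>N\<close>, with a fixed \<open>\<theta> < 1\<close>, whereas iterating the flow backwards expands
distances at most by a fixed factor \<open>exp L\<close> per unit of time. Once \<open>exp L * \<theta>\<^sup>N \<le> 1 / 2\<close>, the
points obtained by flowing \<open>\<Psi> k\<close> back by time \<open>k\<close> accumulate at a point whose trajectory shadows
\<open>\<Psi>\<close> (\<open>backward_shadowing\<close>), with an error that is as high a power of the distance to the
sphere as desired. Both parts follow in the same way from the contracted line field \<open>\<L>\<close>, transversal
to the sphere, that the Main Assumption provides.

Distance to the sphere is measured by \<open>depth y = 1 - |y|\<^sup>2\<close>, because
\<open>depth (Theta x) = 1 / (1 + |x|\<^sup>2)\<close> turns powers of \<open>|x|\<close> into powers of the depth. Attraction is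
an infinitesimal statement on the sphere: the derivative of \<open>F t\<close> maps tangent vectors of the
sphere to tangent vectors, so the radial component of the image of a radial vector can be read
off from the line \<open>\<L>(p)\<close>, where it is at most \<open>C * exp (\<mu>\<^sub>2 * t)\<close> by compactness
(\<open>radial_derivative_bound\<close>). Hence for some time \<open>T\<close> the flow halves the depth near the sphere
(\<open>depth_halved_near_boundary\<close>), and summing the depth along the first \<open>T\<close> iterates gives a
function that decreases in every single step (\<open>depth_lyapunov\<close>).

The time change integrates the factor \<open>\<rho>\<close> of the compactification along the transported
trajectories. It is onto the real line because a trajectory of the original flow stays in a
compact set during a bounded time, where \<open>\<rho>\<close> is bounded away from zero
(\<open>compactified_time_change\<close>). Errors in the ball are turned back into errors in the whole space
by \<open>Xi_lipschitz\<close>, at the cost of a fixed negative power of the depth.\<close>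

section \<open>Growth of solutions and Lipschitz flows\<close>

text \<open>Gronwall's inequality: \<open>exp (- 2 * C * t) * |w t|\<^sup>2\<close> is nonincreasing.\<close>

lemma norm_growth_bound_forward:
  fixes w :: "real \<Rightarrow> 'a::real_inner"
  assumes deriv: "\<And>t. (w has_vector_derivative w' t) (at t)"
    and bound: "\<And>s. 0 \<le> s \<Longrightarrow> s \<le> T \<Longrightarrow> norm (w' s) \<le> C * norm (w s)"
    and "0 \<le> T"
  shows "norm (w T) \<le> exp (C * T) * norm (w 0)"
proof -
  define g where "g t = exp (- 2 * C * t) * (w t \<bullet> w t)" for t
  have g': "(g has_real_derivative exp (- 2 * C * t) * (2 * (w t \<bullet> w' t) - 2 * C * (w t \<bullet> w t))) (at t)"
    for t
    unfolding g_def
    using deriv[of t, unfolded has_vector_derivative_def]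
    by (auto simp: has_field_derivative_def algebra_simps inner_commute
             intro!: derivative_eq_intros)
  have le: "exp (- 2 * C * t) * (2 * (w t \<bullet> w' t) - 2 * C * (w t \<bullet> w t)) \<le> 0"
    if "0 \<le> t" "t \<le> T" for t
  proof -
    have "w t \<bullet> w' t \<le> norm (w t) * norm (w' t)" by (rule norm_cauchy_schwarz)
    also have "\<dots> \<le> norm (w t) * (C * norm (w t))"
      by (intro mult_left_mono bound that) auto
    also have "\<dots> = C * (w t \<bullet> w t)"
      by (simp add: power2_norm_eq_inner[symmetric] power2_eq_square)
    finally show ?thesis by (simp add: mult_le_0_iff)
  qed
  have "g T \<le> g 0"
    using g' le by (intro DERIV_nonpos_imp_nonincreasing[OF \<open>0 \<le> T\<close>]) blast
  then have "exp (- 2 * C * T) * (norm (w T))\<^sup>2 \<le> (norm (w 0))\<^sup>2"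
    by (simp add: g_def power2_norm_eq_inner)
  then have "exp (2 * C * T) * (exp (- 2 * C * T) * (norm (w T))\<^sup>2) \<le> exp (2 * C * T) * (norm (w 0))\<^sup>2"
    by (intro mult_left_mono) auto
  then have "(norm (w T))\<^sup>2 \<le> (exp (C * T) * norm (w 0))\<^sup>2"
    by (simp add: mult.assoc[symmetric] exp_add[symmetric] power_mult_distrib exp_double[symmetric])
  then show ?thesis by (rule power2_le_imp_le) simp
qed

lemma norm_growth_bound:
  fixes w :: "real \<Rightarrow> 'a::real_inner"
  assumes deriv: "\<And>t. (w has_vector_derivative w' t) (at t)"
    and bound: "\<And>s. \<bar>s\<bar> \<le> \<bar>t\<bar> \<Longrightarrow> norm (w' s) \<le> C * norm (w s)"
  shows "norm (w t) \<le> exp (C * \<bar>t\<bar>) * norm (w 0)"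
proof (cases "0 \<le> t")
  case True
  then show ?thesis using norm_growth_bound_forward[OF deriv, of t C] bound by auto
next
  case False
  have "((\<lambda>s. w (- s)) has_vector_derivative - w' (- s)) (at s)" for s
  proof -
    have "((\<lambda>s::real. - s) has_vector_derivative -1) (at s)"
      by (auto intro!: derivative_eq_intros)
    from vector_diff_chain_at[OF this deriv[of "-s"]] show ?thesis by (simp add: o_def)
  qed
  from norm_growth_bound_forward[OF this, of "- t" C] bound False show ?thesis by auto
qed

lemma C1_field_lipschitz:
  fixes X :: "real^'n \<Rightarrow> real^'n"
  assumes "C1_vector_field_on M X" "K \<subseteq> M" "compact K" "convex K"
  obtains L where "L \<ge> 0" "\<And>x y. x \<in> K \<Longrightarrow> y \<in> K \<Longrightarrow> norm (X x - X y) \<le> L * norm (x - y)"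
proof -
  obtain X' where X': "\<And>x. x \<in> M \<Longrightarrow> (X has_derivative blinfun_apply (X' x)) (at x within M)"
    and cont: "continuous_on M X'"
    using assms(1) by (auto simp: C1_vector_field_on_def)
  have "bounded (X' ` K)"
    using assms cont by (intro compact_imp_bounded compact_continuous_image)
      (auto intro: continuous_on_subset)
  then obtain L where L: "L > 0" "\<And>x. x \<in> K \<Longrightarrow> norm (X' x) \<le> L"
    by (auto simp: bounded_pos)
  have "norm (X x - X y) \<le> L * norm (x - y)" if "x \<in> K" "y \<in> K" for x y
  proof (rule differentiable_bound[OF \<open>convex K\<close> _ _ that])
    show "(X has_derivative blinfun_apply (X' z)) (at z within K)" if "z \<in> K" for z
      using X' that \<open>K \<subseteq> M\<close> by (blast intro: has_derivative_subset)
    show "onorm (blinfun_apply (X' z)) \<le> L" if "z \<in> K" for z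
      using L(2)[OF that] by (simp add: norm_blinfun.rep_eq)
  qed
  with L(1) show ?thesis by (intro that[of L]) auto
qed

lemma generated_flow_lipschitz:
  fixes Y :: "real^'n \<Rightarrow> real^'n"
  assumes gen: "generates_flow_on M Y F" and "compact M" "convex M"
  shows "\<exists>L\<ge>0. \<forall>t. \<forall>y\<in>M. \<forall>z\<in>M. norm (F t y - F t z) \<le> exp (L * \<bar>t\<bar>) * norm (y - z)"
proof -
  have C1: "C1_vector_field_on M Y" and flow: "flow_on M F"
    and ode: "\<And>x t. x \<in> M \<Longrightarrow> ((\<lambda>s. F s x) has_vector_derivative Y (F t x)) (at t)"
    using gen by (auto simp: generates_flow_on_def)
  obtain L where L: "L \<ge> 0"
    "\<And>x y. x \<in> M \<Longrightarrow> y \<in> M \<Longrightarrow> norm (Y x - Y y) \<le> L * norm (x - y)"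
    using C1_field_lipschitz[OF C1 order_refl assms(2,3)] by blast
  have M: "F t y \<in> M" and F0: "F 0 y = y" if "y \<in> M" for t y
    using flow that by (auto simp: flow_on_def)
  have "norm (F t y - F t z) \<le> exp (L * \<bar>t\<bar>) * norm (y - z)" if "y \<in> M" "z \<in> M" for t y z
  proof -
    have "((\<lambda>t. F t y - F t z) has_vector_derivative (Y (F t y) - Y (F t z))) (at t)" for t
      using ode that by (intro has_vector_derivative_diff) auto
    from norm_growth_bound[OF this, of t L] L(2) M F0 that show ?thesis by auto
  qed
  with L(1) show ?thesis by blast
qed

section \<open>Increasing homeomorphisms as solutions of differential equations\<close>

text \<open>As long as \<open>A\<close> stays below \<open>y\<close>, its values lie in the compact interval from \<open>0\<close> to \<open>y\<close>, on which
its speed is bounded away from zero; so it has to reach \<open>y\<close>.\<close>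

lemma positive_autonomous_ode_attains:
  fixes A c :: "real \<Rightarrow> real"
  assumes ode: "\<And>t. (A has_real_derivative c (A t)) (at t)"
    and c: "continuous_on UNIV c" "\<And>s. c s > 0"
    and "A 0 = 0" "y \<ge> 0"
  shows "\<exists>t. A t = y"
proof -
  have "\<exists>t\<ge>0. y \<le> A t"
  proof (rule ccontr)
    assume "\<not> ?thesis"
    then have less: "A t < y" if "t \<ge> 0" for t using that by force
    have pos: "A t \<ge> 0" if "t \<ge> 0" for t
      using DERIV_nonneg_imp_nondecreasing[OF that, of A] ode c(2) \<open>A 0 = 0\<close>
      by (metis less_imp_le)
    obtain s where s: "s \<in> {0..y}" "\<And>u. u \<in> {0..y} \<Longrightarrow> c s \<le> c u"
    proof -
      have "continuous_on {0..y} c" using c(1) by (rule continuous_on_subset) auto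
      with continuous_attains_inf[of "{0..y}" c] \<open>y \<ge> 0\<close> have
        "\<exists>s\<in>{0..y}. \<forall>u\<in>{0..y}. c s \<le> c u" by auto
      then show thesis using that by blast
    qed
    have "c s * t \<le> A t" if "t \<ge> 0" for t
    proof -
      have "((\<lambda>t. A t - c s * t) has_real_derivative c (A u) - c s) (at u)" for u
        by (auto intro!: derivative_eq_intros ode)
      moreover have "c (A u) - c s \<ge> 0" if "0 \<le> u" for u
        using s(2) pos[OF that] less[OF that] by auto
      ultimately have "A 0 - c s * 0 \<le> A t - c s * t"
        using DERIV_nonneg_imp_nondecreasing[OF that, of "\<lambda>t. A t - c s * t"] by blast
      then show ?thesis using \<open>A 0 = 0\<close> by simp
    qed
    from this[of "y / c s"] less[of "y / c s"] c(2)[of s] \<open>y \<ge> 0\<close> show False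
      by (simp add: field_simps)
  qed
  then obtain t where t: "t \<ge> 0" "y \<le> A t" by auto
  have "continuous_on UNIV A"
    using ode by (auto intro!: DERIV_continuous_on)
  then have "continuous_on {0..t} A" by (rule continuous_on_subset) auto
  from IVT'[OF _ t(2) t(1) this] \<open>A 0 = 0\<close> \<open>y \<ge> 0\<close> show ?thesis by auto
qed

lemma positive_autonomous_ode_Rep:
  fixes A c :: "real \<Rightarrow> real"
  assumes ode: "\<And>t. (A has_real_derivative c (A t)) (at t)"
    and c: "continuous_on UNIV c" "\<And>s. c s > 0"
    and "A 0 = 0"
  shows "A \<in> Rep"
proof -
  have mono: "strict_mono A"
  proof (rule strict_monoI)
    show "A a < A b" if "a < b" for a b
      by (rule DERIV_pos_imp_increasing[OF that]) (use ode c(2) in blast)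
  qed
  have "\<exists>t. A t = y" for y
  proof (cases "y \<ge> 0")
    case True
    then show ?thesis using positive_autonomous_ode_attains[of A c y] assms by simp
  next
    case False
    \<comment> \<open>reversal of time and of the axis maps the half-line of negative values to the other one\<close>
    have "((\<lambda>t. - A (- t)) has_real_derivative c (- (- A (- t)))) (at t)" for t
      using DERIV_minus[OF DERIV_mirror[THEN iffD1, OF ode[of "- t"]]] by simp
    moreover have "continuous_on UNIV (\<lambda>s. c (- s))"
      by (rule continuous_on_compose2[OF c(1)]) (intro continuous_intros, simp)
    ultimately have "\<exists>t. - A (- t) = - y"
      using positive_autonomous_ode_attains[of "\<lambda>t. - A (- t)" "\<lambda>s. c (- s)" "- y"]
        c(2) \<open>A 0 = 0\<close> False by auto
    then obtain t where "- A (- t) = - y" by blast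
    then have "A (- t) = y" by simp
    then show ?thesis by blast
  qed
  then have "range A = UNIV" by (metis surj_def)
  moreover have "continuous_on UNIV A"
    using ode by (auto intro!: DERIV_continuous_on)
  ultimately have "\<exists>g. homeomorphism UNIV UNIV A g"
    using invariance_of_domain_homeomorphism[OF open_UNIV _ _ strict_mono_imp_inj_on[OF mono]]
    by (metis order_refl)
  with mono show ?thesis by (simp add: Rep_def)
qed

section \<open>The ball model of the space\<close>

definition Xi :: "real^'n \<Rightarrow> real^'n" where
  "Xi y = (1 / sqrt (1 - (norm y)\<^sup>2)) *\<^sub>R y"

definition depth :: "real^'n \<Rightarrow> real" where
  "depth y = 1 - (norm y)\<^sup>2"

lemma depth_Theta: "depth (Theta x) = 1 / (1 + (norm x)\<^sup>2)"
proof -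
  have "1 + (norm x)\<^sup>2 > 0" by (simp add: add_pos_nonneg)
  then show ?thesis
    by (simp add: depth_def Theta_def field_simps)
qed

lemma depth_nonneg: "y \<in> cball 0 1 \<Longrightarrow> depth y \<ge> 0"
  by (simp add: depth_def abs_square_le_1)

lemma depth_pos_iff: "depth y > 0 \<longleftrightarrow> norm y < 1"
  by (simp add: depth_def abs_square_less_1)

lemma depth_le_1: "depth y \<le> 1"
  by (simp add: depth_def)

lemma depth_sphere: "y \<in> sphere 0 1 \<Longrightarrow> depth y = 0"
  by (simp add: depth_def)

lemma norm_Theta_less_1: "norm (Theta x) < 1"
  unfolding depth_pos_iff[symmetric] depth_Theta by (simp add: add_pos_nonneg)

lemma Theta_in_cball: "Theta x \<in> cball 0 1"
  using norm_Theta_less_1[of x] by simp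

lemma Xi_Theta: "Xi (Theta x) = x"
proof -
  have pos: "1 + (norm x)\<^sup>2 > 0" by (simp add: add_pos_nonneg)
  have "1 - (norm (Theta x))\<^sup>2 = 1 / (1 + (norm x)\<^sup>2)"
    using depth_Theta[of x] by (simp add: depth_def)
  then show ?thesis
    using pos by (simp add: Xi_def real_sqrt_divide) (simp add: Theta_def add.commute)
qed

lemma Theta_Xi:
  assumes "norm y < 1"
  shows "Theta (Xi y) = y"
proof -
  have pos: "1 - (norm y)\<^sup>2 > 0" using assms depth_pos_iff[of y] by (simp add: depth_def)
  then have "(norm (Xi y))\<^sup>2 + 1 = 1 / (1 - (norm y)\<^sup>2)"
    by (simp add: Xi_def power_divide field_simps)
  then show ?thesis
    using pos by (simp add: Theta_def real_sqrt_divide) (simp add: Xi_def)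
qed

lemma Xi_differentiable:
  assumes "norm y < 1"
  shows "Xi differentiable (at y)"
proof -
  have "1 - (norm y)\<^sup>2 > 0" using assms depth_pos_iff[of y] by (simp add: depth_def)
  then have pos: "1 - y \<bullet> y > 0" by (simp add: power2_norm_eq_inner)
  have "((\<lambda>y. 1 - y \<bullet> y) has_derivative (\<lambda>h. - (y \<bullet> h + h \<bullet> y))) (at y)"
    by (auto intro!: derivative_eq_intros)
  from has_derivative_scaleR[OF Deriv.has_derivative_inverse[OF _ has_derivative_real_sqrt[OF pos this]]
      has_derivative_ident] pos
  show ?thesis
    unfolding differentiable_def Xi_def power2_norm_eq_inner inverse_eq_divide by auto
qed

lemma Theta_differentiable: "Theta differentiable (at x)"
proof -
  have pos: "x \<bullet> x + 1 > 0" by (simp add: add_nonneg_pos)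
  have "((\<lambda>x. x \<bullet> x + 1) has_derivative (\<lambda>h. x \<bullet> h + h \<bullet> x)) (at x)"
    by (auto intro!: derivative_eq_intros)
  from has_derivative_scaleR[OF Deriv.has_derivative_inverse[OF _ has_derivative_real_sqrt[OF pos this]]
      has_derivative_ident] pos
  show ?thesis
    unfolding differentiable_def Theta_def power2_norm_eq_inner inverse_eq_divide by auto
qed

lemma Theta_lipschitz: "norm (Theta x - Theta y) \<le> 2 * norm (x - y)"
proof -
  define a where "a = sqrt ((norm x)\<^sup>2 + 1)"
  define b where "b = sqrt ((norm y)\<^sup>2 + 1)"
  have ab: "a \<ge> 1" "b \<ge> 1" "norm y \<le> b"
    by (auto simp: a_def b_def real_le_rsqrt)
  have "\<bar>norm (x, 1::real) - norm (y, 1::real)\<bar> \<le> norm ((x, 1::real) - (y, 1))"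
    by (rule norm_triangle_ineq3)
  then have diff: "\<bar>a - b\<bar> \<le> norm (x - y)"
    by (simp add: norm_Pair a_def b_def)
  have "Theta x - Theta y = (1 / a) *\<^sub>R (x - y) + ((b - a) / a) *\<^sub>R ((1 / b) *\<^sub>R y)"
  proof -
    have "(b - a) / a * (1 / b) = 1 / a - 1 / b" using ab by (simp add: field_simps)
    then show ?thesis
      unfolding Theta_def a_def[symmetric] b_def[symmetric] scaleR_scaleR
      by (simp add: scaleR_diff_right scaleR_diff_left)
  qed
  also have "norm \<dots> \<le> norm (x - y) / a + \<bar>b - a\<bar> / a * (norm y / b)"
    using ab by (intro norm_triangle_le) simp
  also have "\<dots> \<le> norm (x - y) / 1 + norm (x - y) / 1 * 1"
    using ab diff by (intro add_mono mult_mono divide_left_mono frac_le) auto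
  finally show ?thesis by simp
qed

lemma depth_lipschitz:
  assumes "y \<in> cball 0 1" "z \<in> cball 0 1"
  shows "\<bar>depth y - depth z\<bar> \<le> 2 * norm (y - z)"
proof -
  have "\<bar>depth y - depth z\<bar> = \<bar>norm z - norm y\<bar> * (norm z + norm y)"
  proof -
    have "depth y - depth z = (norm z - norm y) * (norm z + norm y)"
      by (simp add: depth_def power2_eq_square algebra_simps)
    then show ?thesis by (simp add: abs_mult)
  qed
  also have "\<dots> \<le> norm (z - y) * 2"
    using assms by (intro mult_mono norm_triangle_ineq3) auto
  finally show ?thesis by (simp add: norm_minus_commute)
qed

text \<open>The inverse of the compactification is steep at the boundary. Its derivative at depth \<open>c\<close> is of
order \<open>c\<close> to the power \<open>-3/2\<close>; the integer exponent \<open>-2\<close> is weaker since \<open>c \<le> 1\<close>, and suffices.\<close>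

lemma Xi_lipschitz:
  assumes "0 < c" "c \<le> depth y" "c \<le> depth z"
  shows "norm (Xi y - Xi z) \<le> 2 * norm (y - z) / c\<^sup>2"
proof -
  define a where "a = sqrt (depth y)"
  define b where "b = sqrt (depth z)"
  have yz: "norm y < 1" "norm z < 1"
    using assms by (simp_all flip: depth_pos_iff)
  have ab: "a > 0" "b > 0" "a\<^sup>2 = depth y" "b\<^sup>2 = depth z"
    using assms by (auto simp: a_def b_def)
  have c: "c \<le> 1" using assms(2) depth_le_1[of y] by simp
  have "c \<le> sqrt c" using assms c by (intro real_le_rsqrt) (simp add: power2_eq_square mult_left_le)
  moreover have "sqrt c \<le> a" "sqrt c \<le> b" using assms by (auto simp: a_def b_def)
  ultimately have ca: "c \<le> a" "sqrt c \<le> b" "sqrt c \<le> a" by auto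
  have diff: "\<bar>b - a\<bar> * (a + b) \<le> 2 * norm (y - z)"
  proof -
    have "\<bar>b - a\<bar> * (a + b) = \<bar>(b - a) * (a + b)\<bar>" using ab by (simp add: abs_mult)
    also have "(b - a) * (a + b) = depth z - depth y"
      by (simp flip: ab) (simp add: power2_eq_square algebra_simps)
    finally show ?thesis using depth_lipschitz[of z y] yz by (simp add: norm_minus_commute)
  qed
  have "Xi y - Xi z = (1 / a) *\<^sub>R (y - z) + ((b - a) / (a * b)) *\<^sub>R z"
    using ab(1,2) by (simp add: Xi_def a_def[unfolded depth_def, symmetric]
       b_def[unfolded depth_def, symmetric] scaleR_diff_right diff_divide_distrib scaleR_diff_left)
  also have "norm \<dots> \<le> norm (y - z) / a + \<bar>b - a\<bar> / (a * b) * norm z"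
    using ab by (intro norm_triangle_le) simp
  also have "\<dots> \<le> norm (y - z) / c\<^sup>2 + norm (y - z) / c\<^sup>2"
  proof (rule add_mono)
    have "c\<^sup>2 \<le> a"
      using ca(1) c assms(1) by (simp add: power2_eq_square mult_left_le order_trans[OF _ ca(1)])
    then show "norm (y - z) / a \<le> norm (y - z) / c\<^sup>2"
      using assms(1) ab by (intro divide_left_mono) auto
    have "c * (2 * c) \<le> (a * b) * (a + b)"
    proof (rule mult_mono)
      show "c \<le> a * b" using mult_mono[OF ca(3,2)] assms ab by simp
      show "2 * c \<le> a + b" using \<open>c \<le> sqrt c\<close> ca by simp
    qed (use assms ab in auto)
    moreover have "\<bar>b - a\<bar> / (a * b) * norm z \<le> \<bar>b - a\<bar> / (a * b)"
      using yz ab by (intro mult_left_le) auto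
    moreover have "\<bar>b - a\<bar> / (a * b) = \<bar>b - a\<bar> * (a + b) / ((a * b) * (a + b))"
      using ab by simp
    moreover have "\<dots> \<le> (2 * norm (y - z)) / (c * (2 * c))"
      using diff calculation(1) assms ab by (intro frac_le) auto
    ultimately show "\<bar>b - a\<bar> / (a * b) * norm z \<le> norm (y - z) / c\<^sup>2"
      by (simp add: power2_eq_square)
  qed
  finally show ?thesis by simp
qed

section \<open>The time change of the compactification\<close>

lemma continuous_on_Theta: "continuous_on S Theta"
  using Theta_differentiable
  by (intro continuous_at_imp_continuous_on ballI differentiable_imp_continuous_within)

lemma continuous_on_Xi: "continuous_on (ball 0 1) Xi"
  using Xi_differentiable
  by (intro continuous_at_imp_continuous_on ballI differentiable_imp_continuous_within) auto

text \<open>The quantitative content of a \<open>C\<^sup>1\<close> flow on the ball that maps the boundary to itself.\<close>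

locale ball_flow =
  fixes F :: "real \<Rightarrow> real^'n \<Rightarrow> real^'n" and L :: real
  assumes flow: "flow_on (cball 0 1) F"
    and sphere_invariant: "F t ` sphere 0 1 = sphere 0 1"
    and L_nonneg: "L \<ge> 0"
    and lipschitz: "y \<in> cball 0 1 \<Longrightarrow> z \<in> cball 0 1 \<Longrightarrow>
      norm (F t y - F t z) \<le> exp (L * \<bar>t\<bar>) * norm (y - z)"
begin

lemma flow_cball: "y \<in> cball 0 1 \<Longrightarrow> F t y \<in> cball 0 1"
  and flow_0: "y \<in> cball 0 1 \<Longrightarrow> F 0 y = y"
  and flow_add: "y \<in> cball 0 1 \<Longrightarrow> F (s + t) y = F s (F t y)"
  using flow by (auto simp: flow_on_def)

lemma flow_ball:
  assumes "norm y < 1"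
  shows "norm (F t y) < 1"
proof -
  have y: "y \<in> cball 0 1" using assms by simp
  have "F t y \<notin> sphere 0 1"
  proof
    assume "F t y \<in> sphere 0 1"
    then have "F (- t) (F t y) \<in> sphere 0 1" using sphere_invariant[of "- t"] by blast
    moreover have "F (- t) (F t y) = y" using flow_add[OF y, of "- t" t] flow_0[OF y] by simp
    ultimately show False using assms by simp
  qed
  with flow_cball[OF y, of t] show ?thesis by simp
qed

text \<open>The flow on the whole space that is conjugate by \<open>Theta\<close> to the flow in the open ball. The
original flow turns out to be a reparametrization of it.\<close>

definition G :: "real \<Rightarrow> real^'n \<Rightarrow> real^'n" where
  "G t x = Xi (F t (Theta x))"

lemma Theta_G: "Theta (G t x) = F t (Theta x)"
  unfolding G_def by (intro Theta_Xi flow_ball norm_Theta_less_1)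

lemma G_0: "G 0 x = x"
  by (simp add: G_def flow_0[OF Theta_in_cball] Xi_Theta)

lemma G_add: "G (s + t) x = G s (G t x)"
  unfolding G_def[of "s + t"] G_def[of s] Theta_G flow_add[OF Theta_in_cball] ..

lemma continuous_on_G: "continuous_on UNIV (\<lambda>(t, x). G t x)"
proof -
  have "continuous_on (UNIV \<times> cball 0 1) (\<lambda>(t, x). F t x)"
    using flow by (simp add: flow_on_def)
  then have "continuous_on UNIV (\<lambda>p. (\<lambda>(t, x). F t x) (fst p, Theta (snd p)))"
    by (rule continuous_on_compose2)
       (use Theta_in_cball in \<open>auto intro!: continuous_intros continuous_on_compose2[OF continuous_on_Theta]\<close>)
  then have "continuous_on UNIV (\<lambda>p. F (fst p) (Theta (snd p)))" by simp
  then have "continuous_on UNIV (\<lambda>p. Xi (F (fst p) (Theta (snd p))))"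
    by (rule continuous_on_compose2[OF continuous_on_Xi])
       (auto intro!: flow_ball norm_Theta_less_1)
  then show ?thesis by (simp add: G_def case_prod_unfold)
qed

lemma flow_on_G: "flow_on UNIV G"
  unfolding flow_on_def using continuous_on_G G_0 G_add by auto

end

text \<open>The derivative of \<open>Xi\<close> inverts that of \<open>Theta\<close> by the chain rule, so a curve in the ball whose
velocity is the image of \<open>r v\<close> corresponds to a curve with velocity \<open>r v\<close>.\<close>

lemma velocity_pulled_back:
  assumes "norm (\<gamma> t) < 1"
    and "(\<gamma> has_vector_derivative r *\<^sub>R frechet_derivative Theta (at (Xi (\<gamma> t))) v) (at t)"
  shows "((\<lambda>s. Xi (\<gamma> s)) has_vector_derivative r *\<^sub>R v) (at t)"
proof -
  define x where "x = Xi (\<gamma> t)"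
  have x: "Theta x = \<gamma> t" by (simp add: x_def Theta_Xi assms)
  let ?T = "frechet_derivative Theta (at x)" and ?X = "frechet_derivative Xi (at (\<gamma> t))"
  have T: "(Theta has_derivative ?T) (at x)"
    using Theta_differentiable frechet_derivative_works by blast
  have X: "(Xi has_derivative ?X) (at (\<gamma> t))"
    using Xi_differentiable assms frechet_derivative_works by blast
  have "((\<lambda>x. x) has_derivative (\<lambda>h. ?X (?T h))) (at x)"
    using has_derivative_compose[OF T, of Xi ?X] X x by (simp add: Xi_Theta)
  then have id: "?X (?T v) = v"
    using has_derivative_unique[OF _ has_derivative_ident] by metis
  have "((\<lambda>s. Xi (\<gamma> s)) has_derivative (\<lambda>h. ?X (h *\<^sub>R (r *\<^sub>R ?T v)))) (at t)"
    using has_derivative_compose[OF assms(2)[unfolded has_vector_derivative_def] X]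
    by (simp add: x_def)
  moreover have "?X (h *\<^sub>R (r *\<^sub>R ?T v)) = h *\<^sub>R (r *\<^sub>R v)" for h
    using X by (simp add: linear_scale has_derivative_linear id)
  ultimately show ?thesis by (simp add: has_vector_derivative_def)
qed

lemma antiderivative_exists:
  fixes f :: "real \<Rightarrow> real"
  assumes "continuous_on UNIV f"
  obtains A where "A 0 = 0" "\<And>t. (A has_real_derivative f t) (at t)"
proof -
  have "\<exists>F. \<forall>x. - \<infinity> < ereal x \<longrightarrow> ereal x < \<infinity> \<longrightarrow> (F has_vector_derivative f x) (at x)"
    by (rule einterval_antiderivative)
       (use assms in \<open>auto simp: continuous_on_eq_continuous_at\<close>)
  then obtain F where F: "\<And>x. (F has_real_derivative f x) (at x)"
    by (auto simp: has_real_derivative_iff_has_vector_derivative)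
  show thesis
  proof (rule that[of "\<lambda>t. F t - F 0"])
    show "F 0 - F 0 = 0" by simp
    show "((\<lambda>t. F t - F 0) has_real_derivative f t) (at t)" for t
      using F by (auto intro!: derivative_eq_intros)
  qed
qed

text \<open>Both sides solve the nonautonomous equation \<open>u' = r t *\<^sub>R X u\<close>. On a bounded time interval they
stay in a ball where \<open>X\<close> is Lipschitz, so they agree by the growth estimate.\<close>

lemma reparametrized_orbit:
  fixes X :: "real^'n \<Rightarrow> real^'n"
  assumes gen: "generates_flow_on UNIV X \<Phi>"
    and A: "A 0 = 0" "\<And>t. (A has_real_derivative r t) (at t)"
    and r: "continuous_on UNIV r"
    and u: "u 0 = x" "\<And>t. (u has_vector_derivative r t *\<^sub>R X (u t)) (at t)"
  shows "\<Phi> (A t) x = u t"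
proof -
  have C1: "C1_vector_field_on UNIV X"
    and ode: "\<And>x t. ((\<lambda>s. \<Phi> s x) has_vector_derivative X (\<Phi> t x)) (at t)"
    and "\<Phi> 0 x = x"
    using gen by (auto simp: generates_flow_on_def flow_on_def)
  define v where "v t = \<Phi> (A t) x" for t
  have v: "(v has_vector_derivative r t *\<^sub>R X (v t)) (at t)" for t
    using vector_diff_chain_at[OF _ ode, of A "r t" t x] A(2)[of t]
    unfolding v_def o_def by (simp add: has_real_derivative_iff_has_vector_derivative)
  define I where "I = {- \<bar>t\<bar>..\<bar>t\<bar>}"
  have cont: "continuous_on I u" "continuous_on I v"
    using u(2) v by (auto intro!: continuous_at_imp_continuous_on has_vector_derivative_continuous)
  have "compact I" by (simp add: I_def)
  have "bounded (u ` I \<union> v ` I)"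
    using cont \<open>compact I\<close> by (intro bounded_Un[THEN iffD2] conjI compact_imp_bounded compact_continuous_image)
  then obtain B where B: "\<And>y. y \<in> u ` I \<union> v ` I \<Longrightarrow> norm y \<le> B"
    by (auto simp: bounded_iff)
  have "bounded (r ` I)"
    using r \<open>compact I\<close> by (intro compact_imp_bounded compact_continuous_image)
      (auto intro: continuous_on_subset)
  then obtain R where R: "\<And>s. s \<in> I \<Longrightarrow> \<bar>r s\<bar> \<le> R"
    by (auto simp: bounded_iff)
  obtain L where L: "L \<ge> 0"
    "\<And>y z. y \<in> cball 0 B \<Longrightarrow> z \<in> cball 0 B \<Longrightarrow> norm (X y - X z) \<le> L * norm (y - z)"
    using C1_field_lipschitz[OF C1 _ compact_cball convex_cball] by blast
  have "((\<lambda>t. v t - u t) has_vector_derivative r t *\<^sub>R X (v t) - r t *\<^sub>R X (u t)) (at t)" for t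
    by (intro has_vector_derivative_diff u v)
  moreover have "norm (r s *\<^sub>R X (v s) - r s *\<^sub>R X (u s)) \<le> R * L * norm (v s - u s)"
    if "\<bar>s\<bar> \<le> \<bar>t\<bar>" for s
  proof -
    have s: "s \<in> I" using that by (auto simp: I_def)
    have "norm (r s *\<^sub>R X (v s) - r s *\<^sub>R X (u s)) = \<bar>r s\<bar> * norm (X (v s) - X (u s))"
      by (simp flip: scaleR_diff_right)
    also have "\<dots> \<le> R * (L * norm (v s - u s))"
      using R[OF s] L B s by (intro mult_mono) auto
    finally show ?thesis by simp
  qed
  ultimately have "norm (v t - u t) \<le> exp (R * L * \<bar>t\<bar>) * norm (v 0 - u 0)"
    by (rule norm_growth_bound)
  then show ?thesis using u(1) A(1) \<open>\<Phi> 0 x = x\<close> by (simp add: v_def)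
qed

text \<open>Here \<open>\<alpha> t x\<close> is the integral of \<open>\<rho>\<close> along \<open>G\<close>. Since the trajectory of \<open>x\<close> under \<open>G\<close> is the
reparametrized trajectory under \<open>\<Phi>\<close>, the function \<open>\<alpha>\<close> also solves an autonomous equation whose
right-hand side \<open>\<lambda>s. \<rho> (\<Phi> s x)\<close> is defined and positive on the whole line, whence it belongs
to \<open>Rep\<close>.\<close>

lemma compactified_time_change:
  fixes X :: "real^'n \<Rightarrow> real^'n"
  assumes gen: "generates_flow_on UNIV X \<Phi>"
    and field: "compactified_field X Y"
    and genY: "generates_flow_on (cball 0 1) Y F"
    and "ball_flow F L"
  shows "\<exists>\<alpha>. time_change \<Phi> \<alpha> \<and> (\<forall>t x. \<Phi> (\<alpha> t x) x = ball_flow.G F t x)"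
proof -
  interpret ball_flow F L by fact
  obtain \<rho> :: "real^'n \<Rightarrow> real" where \<rho>: "continuous_on UNIV \<rho>" "\<And>x. \<rho> x > 0"
    and Y: "\<And>x. Y (Theta x) = \<rho> x *\<^sub>R frechet_derivative Theta (at x) (X x)"
    using field by (auto simp: compactified_field_def)
  have ode: "((\<lambda>s. F s y) has_vector_derivative Y (F t y)) (at t)" if "y \<in> cball 0 1" for y t
    using genY that by (auto simp: generates_flow_on_def)
  have G': "((\<lambda>t. G t x) has_vector_derivative \<rho> (G t x) *\<^sub>R X (G t x)) (at t)" for t x
    unfolding G_def
  proof (rule velocity_pulled_back)
    show "norm (F t (Theta x)) < 1" by (intro flow_ball norm_Theta_less_1)
    show "((\<lambda>s. F s (Theta x)) has_vector_derivative \<rho> (Xi (F t (Theta x))) *\<^sub>R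
        frechet_derivative Theta (at (Xi (F t (Theta x)))) (X (Xi (F t (Theta x))))) (at t)"
      using ode[OF Theta_in_cball, of x t] Y[of "G t x"] unfolding Theta_G by (simp add: G_def)
  qed
  have cont: "continuous_on UNIV (\<lambda>t. \<rho> (G t x))" for x
  proof -
    have "continuous_on UNIV (\<lambda>t. (\<lambda>(t, x). G t x) (t, x))"
      by (rule continuous_on_compose2[OF continuous_on_G]) (auto intro!: continuous_intros)
    then show ?thesis by (intro continuous_on_compose2[OF \<rho>(1)]) auto
  qed
  have "\<exists>A. A 0 = 0 \<and> (\<forall>t. (A has_real_derivative \<rho> (G t x)) (at t))" for x
    using antiderivative_exists[OF cont[of x]] by blast
  then obtain \<alpha> where \<alpha>: "\<And>x. \<alpha> x 0 = 0"
      "\<And>x t. (\<alpha> x has_real_derivative \<rho> (G t x)) (at t)"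
    by metis
  have eq: "\<Phi> (\<alpha> x t) x = G t x" for t x
    using reparametrized_orbit[OF gen \<alpha>(1) \<alpha>(2) cont G_0 G'] .
  show ?thesis
  proof (intro exI[of _ "\<lambda>t x. \<alpha> x t"] conjI allI)
    show "\<Phi> (\<alpha> x t) x = G t x" for t x by (fact eq)
    have "\<alpha> x \<in> Rep" for x
    proof (rule positive_autonomous_ode_Rep)
      show "(\<alpha> x has_real_derivative \<rho> (\<Phi> (\<alpha> x t) x)) (at t)" for t
        using \<alpha>(2) eq by simp
      have "continuous_on (UNIV \<times> UNIV) (\<lambda>(t, x). \<Phi> t x)"
        using gen by (simp add: generates_flow_on_def flow_on_def)
      then have "continuous_on UNIV (\<lambda>t. (\<lambda>(t, x). \<Phi> t x) (t, x))"
        by (rule continuous_on_compose2) (auto intro!: continuous_intros)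
      then show "continuous_on UNIV (\<lambda>s. \<rho> (\<Phi> s x))"
        by (intro continuous_on_compose2[OF \<rho>(1)]) auto
    qed (use \<rho>(2) \<alpha>(1) in auto)
    then show "time_change \<Phi> (\<lambda>t x. \<alpha> x t)"
      using flow_on_G by (simp add: time_change_def eq \<alpha>(1))
  qed
qed

section \<open>Attraction of the sphere\<close>

text \<open>Otherwise points at which the line makes smaller and smaller angles with the tangent space would
accumulate at a point where the line is tangent.\<close>

lemma line_field_uniformly_transversal:
  fixes \<Lambda> :: "(real^'n) set"
  assumes "compact \<Lambda>" "continuous_line_field \<Lambda> \<L>"
    and transv: "\<And>p. p \<in> \<Lambda> \<Longrightarrow> \<not> \<L> p \<subseteq> tangent_boundary p"
  obtains c where "c > 0" "\<And>p v. p \<in> \<Lambda> \<Longrightarrow> v \<in> \<L> p \<Longrightarrow> c * norm v \<le> \<bar>v \<bullet> p\<bar>"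
proof (rule ccontr)
  assume contra: "\<not> thesis"
  have "\<exists>p v. p \<in> \<Lambda> \<and> v \<in> \<L> p \<and> \<bar>v \<bullet> p\<bar> < inverse (Suc n) * norm v" for n
  proof (rule ccontr)
    assume "\<not> ?thesis"
    then have "inverse (Suc n) * norm v \<le> \<bar>v \<bullet> p\<bar>" if "p \<in> \<Lambda>" "v \<in> \<L> p" for p v
      using that by (metis not_le)
    then show False using contra that[of "inverse (Suc n)"] by simp
  qed
  then obtain p v where pv: "\<And>n. p n \<in> \<Lambda>" "\<And>n. v n \<in> \<L> (p n)"
    "\<And>n. \<bar>v n \<bullet> p n\<bar> < inverse (Suc n) * norm (v n)"
    by metis
  obtain q r where q: "q \<in> \<Lambda>" and r: "strict_mono r" "(p \<circ> r) \<longlonglongrightarrow> q"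
    using \<open>compact \<Lambda>\<close> pv(1) unfolding compact_def by meson
  obtain W w where W: "openin (top_of_set \<Lambda>) W" "q \<in> W" "continuous_on W w"
      "\<And>q. q \<in> W \<Longrightarrow> w q \<noteq> 0 \<and> \<L> q = span {w q}"
    using assms(2) q unfolding continuous_line_field_def by meson
  \<comment> \<open>near the limit \<open>q\<close> the line field is spanned by \<open>w\<close>, which makes the angle continuous\<close>
  obtain O' where O': "open O'" "W = \<Lambda> \<inter> O'" using W(1) by (auto simp: openin_open)
  have ev: "\<forall>\<^sub>F n in sequentially. (p \<circ> r) n \<in> W"
    using topological_tendstoD[OF r(2) O'(1)] W(2) O'(2) pv(1) by auto
  have wlim: "(\<lambda>n. w ((p \<circ> r) n)) \<longlonglongrightarrow> w q"
    using continuous_on_tendsto_compose[OF W(3) r(2) W(2)] ev by simp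
  have "\<forall>\<^sub>F n in sequentially. \<bar>w ((p \<circ> r) n) \<bullet> (p \<circ> r) n\<bar> \<le> inverse (Suc (r n)) * norm (w ((p \<circ> r) n))"
    using ev
  proof eventually_elim
    case (elim n)
    obtain a where a: "v (r n) = a *\<^sub>R w (p (r n))"
      using pv(2)[of "r n"] W(4) elim by (auto simp: span_singleton)
    have "a \<noteq> 0" using pv(3)[of "r n"] a by auto
    have "\<bar>a\<bar> * \<bar>w (p (r n)) \<bullet> p (r n)\<bar> \<le> \<bar>a\<bar> * (inverse (Suc (r n)) * norm (w (p (r n))))"
      using pv(3)[of "r n"] unfolding a by (simp add: abs_mult mult_ac)
    then show ?case using \<open>a \<noteq> 0\<close> by simp
  qed
  moreover have "(\<lambda>n. \<bar>w ((p \<circ> r) n) \<bullet> (p \<circ> r) n\<bar>) \<longlonglongrightarrow> \<bar>w q \<bullet> q\<bar>"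
    by (intro tendsto_intros wlim r)
  moreover have "(\<lambda>n. inverse (Suc (r n)) * norm (w ((p \<circ> r) n))) \<longlonglongrightarrow> 0 * norm (w q)"
    using LIMSEQ_subseq_LIMSEQ[OF LIMSEQ_inverse_real_of_nat r(1)]
    by (intro tendsto_mult tendsto_norm wlim) (simp add: o_def)
  ultimately have "\<bar>w q \<bullet> q\<bar> \<le> 0 * norm (w q)"
    by (intro tendsto_le[OF sequentially_bot])
  then have "w q \<bullet> q = 0" by simp
  then have "\<L> q \<subseteq> tangent_boundary q"
    using W(2,4) by (auto simp: tangent_boundary_def span_singleton)
  with transv q show False by blast
qed

lemma has_derivative_flow_derivative:
  "F t differentiable (at p within cball 0 1) \<Longrightarrow>
    (F t has_derivative flow_derivative F t p) (at p within cball 0 1)"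
  unfolding flow_derivative_def by (rule frechet_derivative_works[THEN iffD1])

text \<open>Along a great circle \<open>c\<close> through \<open>p\<close> the norm of \<open>F t (c s)\<close> is constantly one; differentiate its
square.\<close>

lemma flow_derivative_tangent:
  fixes p v :: "real^'n"
  assumes sphere: "\<And>q. q \<in> sphere 0 1 \<Longrightarrow> F t q \<in> sphere 0 1"
    and diff: "F t differentiable (at p within cball 0 1)"
    and p: "p \<in> sphere 0 1" and "v \<bullet> p = 0"
  shows "flow_derivative F t p v \<bullet> F t p = 0"
proof (cases "v = 0")
  case True
  let ?D = "flow_derivative F t p"
  have "(F t has_derivative ?D) (at p within cball 0 1)"
    using diff by (rule has_derivative_flow_derivative)
  then show ?thesis using True by (simp add: linear_0 has_derivative_linear)
next
  case False
  let ?D = "flow_derivative F t p"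
  have D: "(F t has_derivative ?D) (at p within cball 0 1)"
    using diff by (rule has_derivative_flow_derivative)
  define u where "u = v /\<^sub>R norm v"
  have u: "u \<bullet> u = 1" "u \<bullet> p = 0" "p \<bullet> p = 1"
    using False assms by (auto simp: u_def power2_norm_eq_inner[symmetric] power_divide)
  define c where "c s = cos s *\<^sub>R p + sin s *\<^sub>R u" for s
  have c_sphere: "c s \<in> sphere 0 1" for s
  proof -
    have "(norm (c s))\<^sup>2 = (cos s)\<^sup>2 + (sin s)\<^sup>2"
      using u unfolding power2_norm_eq_inner
      by (simp add: c_def inner_add_left inner_add_right inner_commute[of p u] power2_eq_square)
    then show ?thesis by (simp add: power2_eq_1_iff) (use norm_ge_zero[of "c s"] in linarith)
  qed
  have "(c has_derivative (\<lambda>h. h *\<^sub>R u)) (at 0)"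
    unfolding c_def by (auto intro!: derivative_eq_intros)
  moreover have "(F t has_derivative ?D) (at (c 0) within range c)"
    using D c_sphere by (intro has_derivative_subset[OF _ image_subsetI]) (auto simp: c_def[of 0])
  ultimately have "((\<lambda>s. F t (c s)) has_derivative (\<lambda>h. ?D (h *\<^sub>R u))) (at 0)"
    by (rule has_derivative_in_compose)
  from has_derivative_inner[OF this this]
  have "((\<lambda>s. F t (c s) \<bullet> F t (c s)) has_derivative
      (\<lambda>h. F t p \<bullet> ?D (h *\<^sub>R u) + ?D (h *\<^sub>R u) \<bullet> F t p)) (at 0)"
    by (simp add: c_def[of 0])
  moreover have "(\<lambda>s. F t (c s) \<bullet> F t (c s)) = (\<lambda>s. 1)"
    using sphere[OF c_sphere] by (auto simp: power2_norm_eq_inner[symmetric])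
  ultimately have "((\<lambda>s::real. 1::real) has_derivative
      (\<lambda>h. F t p \<bullet> ?D (h *\<^sub>R u) + ?D (h *\<^sub>R u) \<bullet> F t p)) (at 0)" by simp
  then have "(\<lambda>h. F t p \<bullet> ?D (h *\<^sub>R u) + ?D (h *\<^sub>R u) \<bullet> F t p) = (\<lambda>h. 0)"
    by (rule has_derivative_unique[OF _ has_derivative_const])
  then have "F t p \<bullet> ?D (norm v *\<^sub>R u) + ?D (norm v *\<^sub>R u) \<bullet> F t p = 0" by meson
  then show ?thesis using False by (simp add: u_def inner_commute)
qed

text \<open>Modulo tangent vectors, which do not contribute, the radial vector \<open>p\<close> is a multiple of a vector
\<open>w\<close> of the line, and transversality bounds the multiple by \<open>1 / (c |w|)\<close>.\<close>

lemma radial_derivative_bound: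
  fixes p :: "real^'n"
  assumes MA: "main_assumption_0_3 F (sphere 0 1) \<L> \<mu>\<^sub>1 \<mu>\<^sub>2 C\<^sub>0"
    and c: "c > 0" "\<And>p v. p \<in> sphere 0 1 \<Longrightarrow> v \<in> \<L> p \<Longrightarrow> c * norm v \<le> \<bar>v \<bullet> p\<bar>"
    and p: "p \<in> sphere 0 1" and "t \<ge> 0"
  shows "\<bar>flow_derivative F t p p \<bullet> F t p\<bar> \<le> C\<^sub>0 * exp (\<mu>\<^sub>2 * t) / c"
proof -
  let ?D = "flow_derivative F t p"
  have diff: "F t differentiable (at p within cball 0 1)"
    and inv: "\<And>t. F t ` sphere 0 1 = sphere 0 1"
    and "dim (\<L> p) = 1"
    and contr: "\<And>v. v \<in> \<L> p \<Longrightarrow> norm (?D v) \<le> C\<^sub>0 * exp (\<mu>\<^sub>2 * t) * norm v"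
    using MA p \<open>t \<ge> 0\<close> by (auto simp: main_assumption_0_3_def C1_flow_on_ball_def
      locally_maximal_invariant_def)
  have lin: "linear ?D"
    using has_derivative_flow_derivative[of F t, OF diff] by (rule has_derivative_linear)
  have "\<not> \<L> p \<subseteq> {0}" using \<open>dim (\<L> p) = 1\<close> dim_eq_0[of "\<L> p"] by auto
  then obtain w where w: "w \<in> \<L> p" "w \<noteq> 0" by auto
  have wp: "c * norm w \<le> \<bar>w \<bullet> p\<bar>" using c p w by auto
  moreover have "c * norm w > 0" using c w by simp
  ultimately have wp0: "w \<bullet> p \<noteq> 0" by auto
  define u where "u = p - w /\<^sub>R (w \<bullet> p)"
  have "u \<bullet> p = 0" using p wp0 by (simp add: u_def inner_diff_left power2_norm_eq_inner[symmetric])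
  have "?D u \<bullet> F t p = 0"
  proof (rule flow_derivative_tangent[of F t, OF _ diff p \<open>u \<bullet> p = 0\<close>])
    show "F t q \<in> sphere 0 1" if "q \<in> sphere 0 1" for q using inv that by blast
  qed
  moreover have "?D p = ?D u + ?D w /\<^sub>R (w \<bullet> p)"
    using lin by (simp add: u_def linear_diff linear_scale)
  ultimately have "?D p \<bullet> F t p = (?D w \<bullet> F t p) / (w \<bullet> p)"
    by (simp add: inner_add_left divide_inverse_commute)
  moreover have "\<bar>?D w \<bullet> F t p\<bar> \<le> C\<^sub>0 * exp (\<mu>\<^sub>2 * t) * norm w"
  proof -
    have "F t p \<in> sphere 0 1" using inv p by blast
    then show ?thesis
      using Cauchy_Schwarz_ineq2[of "?D w" "F t p"] contr[OF w(1)] by simp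
  qed
  ultimately have "\<bar>?D p \<bullet> F t p\<bar> \<le> (C\<^sub>0 * exp (\<mu>\<^sub>2 * t) * norm w) / (c * norm w)"
    using wp c w by (simp only: abs_divide) (intro frac_le, auto)
  then show ?thesis using w by simp
qed

text \<open>Continuity of the derivative is known for each fixed vector only, so the vector, which moves with
the point, is expanded in the standard basis.\<close>

lemma continuous_on_radial_derivative:
  fixes F :: "real \<Rightarrow> real^'n \<Rightarrow> real^'n"
  assumes "C1_flow_on_ball F"
  shows "continuous_on (cball 0 1) (\<lambda>x. flow_derivative F t x x \<bullet> F t x)"
proof -
  let ?D = "flow_derivative F t"
  have flow: "flow_on (cball 0 1) F"
    and diff: "\<And>x. x \<in> cball 0 1 \<Longrightarrow> F t differentiable (at x within cball 0 1)"
    and cont: "\<And>v. continuous_on (UNIV \<times> cball 0 1) (\<lambda>(t, p). flow_derivative F t p v)"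
    using assms by (auto simp: C1_flow_on_ball_def)
  have D: "continuous_on (cball 0 1) (\<lambda>x. ?D x v)" for v
  proof -
    have "continuous_on (cball 0 1) (\<lambda>x. (\<lambda>(t, p). flow_derivative F t p v) (t, x))"
      by (rule continuous_on_compose2[OF cont]) (auto intro!: continuous_intros)
    then show ?thesis by simp
  qed
  have "continuous_on (cball 0 1) (F t)"
    using diff by (simp add: continuous_on_eq_continuous_within differentiable_imp_continuous_within)
  then have "continuous_on (cball 0 1) (\<lambda>x. (\<Sum>b\<in>Basis. (x \<bullet> b) *\<^sub>R ?D x b) \<bullet> F t x)"
    by (intro continuous_intros D)
  moreover have "?D x x = (\<Sum>b\<in>Basis. (x \<bullet> b) *\<^sub>R ?D x b)" if "x \<in> cball 0 1" for x
  proof -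
    have lin: "linear (?D x)"
      using has_derivative_flow_derivative[of F t, OF diff[OF that]] by (rule has_derivative_linear)
    have "?D x x = ?D x (\<Sum>b\<in>Basis. (x \<bullet> b) *\<^sub>R b)" by (simp add: euclidean_representation)
    also have "\<dots> = (\<Sum>b\<in>Basis. (x \<bullet> b) *\<^sub>R ?D x b)"
      using lin by (simp add: linear_sum linear_scale)
    finally show ?thesis .
  qed
  ultimately show ?thesis by (metis (no_types, lifting) continuous_on_cong)
qed

text \<open>On the sphere the radial derivative of \<open>F T\<close> is small for large \<open>T\<close>, hence also near the sphere by
uniform continuity. The mean value theorem along a radius, at whose end the depth of \<open>F T\<close>
vanishes, turns this into a bound for the depth.\<close>

lemma depth_halved_near_boundary:
  fixes F :: "real \<Rightarrow> real^'n \<Rightarrow> real^'n"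
  assumes MA: "main_assumption_0_3 F (sphere 0 1) \<L> \<mu>\<^sub>1 \<mu>\<^sub>2 C\<^sub>0" and "\<mu>\<^sub>2 < 0"
  shows "\<exists>(T::nat) r. T \<ge> (1::nat) \<and> r > 0 \<and>
    (\<forall>y\<in>cball 0 1. 1 - norm y < r \<longrightarrow> depth (F T y) \<le> depth y / 2)"
proof -
  have C1: "C1_flow_on_ball F" and inv: "\<And>t. F t ` sphere 0 1 = sphere 0 1"
    and "C\<^sub>0 > 0"
    using MA by (auto simp: main_assumption_0_3_def locally_maximal_invariant_def)
  obtain c where c: "c > 0" "\<And>p v. p \<in> sphere 0 1 \<Longrightarrow> v \<in> \<L> p \<Longrightarrow> c * norm v \<le> \<bar>v \<bullet> p\<bar>"
    using line_field_uniformly_transversal[of "sphere 0 1" \<L>] MA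
    by (auto simp: main_assumption_0_3_def)
  have "(\<lambda>n. exp \<mu>\<^sub>2 ^ n) \<longlonglongrightarrow> 0" using \<open>\<mu>\<^sub>2 < 0\<close> by (intro LIMSEQ_power_zero) auto
  then have "\<forall>\<^sub>F n in sequentially. exp \<mu>\<^sub>2 ^ n < c / (16 * C\<^sub>0)"
    using c \<open>C\<^sub>0 > 0\<close> by (intro order_tendstoD) auto
  then have "\<forall>\<^sub>F n in sequentially. exp \<mu>\<^sub>2 ^ n < c / (16 * C\<^sub>0) \<and> n \<ge> 1"
    using eventually_ge_at_top by (rule eventually_conj)
  then obtain T :: nat where T: "exp \<mu>\<^sub>2 ^ T < c / (16 * C\<^sub>0)" "T \<ge> 1"
    by (auto simp: eventually_sequentially)
  define k where "k x = flow_derivative F T x x \<bullet> F T x" for x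
  have k_sphere: "\<bar>k p\<bar> \<le> 1 / 16" if "p \<in> sphere 0 1" for p
  proof -
    have "\<bar>k p\<bar> \<le> C\<^sub>0 * exp (\<mu>\<^sub>2 * T) / c"
      unfolding k_def by (rule radial_derivative_bound[OF MA c that]) auto
    also have "\<dots> = exp \<mu>\<^sub>2 ^ T * (C\<^sub>0 / c)" by (simp add: exp_of_nat2_mult)
    also have "\<dots> \<le> c / (16 * C\<^sub>0) * (C\<^sub>0 / c)"
      using T c \<open>C\<^sub>0 > 0\<close> by (intro mult_right_mono) auto
    finally show ?thesis using c \<open>C\<^sub>0 > 0\<close> by simp
  qed
  have "uniformly_continuous_on (cball 0 1) k"
    unfolding k_def by (intro compact_uniformly_continuous continuous_on_radial_derivative C1) simp
  then obtain d where d: "d > 0" "\<And>x y. x \<in> cball 0 1 \<Longrightarrow> y \<in> cball 0 1 \<Longrightarrow> dist y x < d \<Longrightarrow>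
      dist (k y) (k x) < 1 / 16"
    unfolding uniformly_continuous_on_def by (metis zero_less_divide_1_iff zero_less_numeral)
  define r where "r = min d (1 / 2)"
  have "depth (F T y) \<le> depth y / 2" if y: "y \<in> cball 0 1" "1 - norm y < r" for y
  proof (cases "norm y = 1")
    case True
    then have "y \<in> sphere 0 1" by simp
    then have "F T y \<in> sphere 0 1" using inv by blast
    with True show ?thesis by (simp add: depth_def)
  next
    case False
    define a where "a = norm y"
    have a: "1 / 2 < a" "a < 1" "1 - a < d" using y False by (auto simp: r_def a_def)
    define p where "p = y /\<^sub>R a"
    have p: "norm p = 1" "y = a *\<^sub>R p" 
    proof -
      have "a \<noteq> 0" using a by simp
      then show "norm p = 1" "y = a *\<^sub>R p" by (auto simp: p_def a_def)
    qed
    define H where "H s = depth (F T (s *\<^sub>R p))" for s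
    have H': "(H has_derivative (\<lambda>h. h * (- 2 * k (s *\<^sub>R p) / s))) (at s within {a..1})"
      if s: "a \<le> s" "s \<le> 1" for s
    proof -
      let ?D = "flow_derivative F T (s *\<^sub>R p)"
      have "F T differentiable (at (s *\<^sub>R p) within cball 0 1)"
        using C1 s a p by (auto simp: C1_flow_on_ball_def)
      then have D: "(F T has_derivative ?D) (at (s *\<^sub>R p) within cball 0 1)"
        by (rule has_derivative_flow_derivative)
      then have lin: "linear ?D" by (rule has_derivative_linear)
      have "((\<lambda>s. s *\<^sub>R p) has_derivative (\<lambda>h. h *\<^sub>R p)) (at s within {a..1})"
        by (auto intro!: derivative_eq_intros)
      moreover have "(F T has_derivative ?D) (at (s *\<^sub>R p) within (\<lambda>s. s *\<^sub>R p) ` {a..1})"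
        using D a p by (intro has_derivative_subset[OF _ image_subsetI]) auto
      ultimately have "((\<lambda>s. F T (s *\<^sub>R p)) has_derivative (\<lambda>h. ?D (h *\<^sub>R p))) (at s within {a..1})"
        by (rule has_derivative_in_compose)
      from has_derivative_diff[OF has_derivative_const has_derivative_inner[OF this this], of 1]
      have "(H has_derivative (\<lambda>h. 0 - (F T (s *\<^sub>R p) \<bullet> ?D (h *\<^sub>R p) + ?D (h *\<^sub>R p) \<bullet> F T (s *\<^sub>R p))))
          (at s within {a..1})"
        unfolding H_def depth_def power2_norm_eq_inner .
      moreover have "0 - (F T (s *\<^sub>R p) \<bullet> ?D (h *\<^sub>R p) + ?D (h *\<^sub>R p) \<bullet> F T (s *\<^sub>R p)) =
          h * (- 2 * k (s *\<^sub>R p) / s)" for h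
        using s a lin by (simp add: k_def linear_scale inner_commute)
      ultimately show ?thesis by simp
    qed
    obtain s where s: "s \<in> {a<..<1}" "H 1 - H a = (1 - a) * (- 2 * k (s *\<^sub>R p) / s)"
      using mvt_simple[OF a(2) H'] by auto
    have "dist (s *\<^sub>R p) p = 1 - s"
    proof -
      have "s *\<^sub>R p - p = (s - 1) *\<^sub>R p" by (simp add: algebra_simps)
      then show ?thesis using p s by (simp add: dist_norm)
    qed
    then have "dist (k (s *\<^sub>R p)) (k p) < 1 / 16"
      using p s a by (intro d(2)) auto
    then have "\<bar>k (s *\<^sub>R p)\<bar> \<le> 1 / 8"
      using k_sphere[of p] p(1) abs_triangle_ineq2[of "k (s *\<^sub>R p)" "k p"]
      by (simp add: dist_real_def)
    then have "2 * k (s *\<^sub>R p) / s \<le> 1 / 2"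
      using s a abs_ge_self[of "k (s *\<^sub>R p)"] by (simp add: pos_divide_le_eq)
    then have "(1 - a) * (2 * k (s *\<^sub>R p) / s) \<le> (1 - a) * (1 / 2)"
      using a by (intro mult_left_mono) auto
    moreover have "H 1 = 0"
    proof -
      have "F T p \<in> sphere 0 1" using inv p by (metis image_eqI mem_sphere_0)
      then show ?thesis by (simp add: H_def depth_sphere)
    qed
    ultimately have "H a \<le> (1 - a) * (1 / 2)" using s(2) by simp
    moreover have "1 - a \<le> depth y"
      using a by (simp add: depth_def a_def[symmetric] power2_eq_square mult_left_le)
    ultimately show ?thesis by (simp add: H_def p(2)[symmetric])
  qed
  moreover have "r > 0" using d by (simp add: r_def)
  ultimately show ?thesis using T(2) by blast
qed

section \<open>A function decreasing in each step\<close>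

context ball_flow
begin

text \<open>Compare \<open>y\<close> with the nearest point of the sphere, whose trajectory stays at depth zero.\<close>

lemma depth_flow_le:
  assumes y: "y \<in> cball 0 1"
  shows "depth (F t y) \<le> 2 * exp (L * \<bar>t\<bar>) * depth y"
proof -
  obtain p where p: "p \<in> sphere 0 1" "norm (y - p) \<le> depth y"
  proof (cases "y = 0")
    case True
    then show thesis using that[of "axis undefined 1"] by (simp add: depth_def)
  next
    case False
    have "y - y /\<^sub>R norm y = (1 - inverse (norm y)) *\<^sub>R y" by (simp add: scaleR_diff_left)
    then have "norm (y - y /\<^sub>R norm y) = 1 - norm y"
    proof -
      have "\<bar>1 - inverse (norm y)\<bar> = inverse (norm y) - 1"
        using False y one_le_inverse[of "norm y"] by simp
      then show ?thesis
        using False \<open>y - y /\<^sub>R norm y = _\<close> by (simp add: left_diff_distrib)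
    qed
    also have "\<dots> \<le> depth y" using y by (simp add: depth_def power2_eq_square mult_left_le)
    finally show thesis using False by (intro that[of "y /\<^sub>R norm y"]) auto
  qed
  have "F t p \<in> sphere 0 1" using sphere_invariant p by blast
  have p_cball: "p \<in> cball 0 1" using p by simp
  have "depth (F t y) = \<bar>depth (F t y) - depth (F t p)\<bar>"
    using depth_sphere[OF \<open>F t p \<in> sphere 0 1\<close>] depth_nonneg[OF flow_cball[OF y]] by simp
  also have "\<dots> \<le> 2 * norm (F t y - F t p)"
    by (intro depth_lipschitz flow_cball y p_cball)
  also have "\<dots> \<le> 2 * (exp (L * \<bar>t\<bar>) * norm (y - p))"
    using lipschitz[OF y p_cball, of t] by simp
  also have "\<dots> \<le> 2 * (exp (L * \<bar>t\<bar>) * depth y)"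
    using p by simp
  finally show ?thesis by simp
qed

text \<open>Let \<open>V\<close> be the sum of the depths of the first \<open>T\<close> iterates. One step of the flow replaces the term
\<open>depth y\<close> by \<open>depth (F T y) \<le> depth y / 2\<close>.\<close>

lemma depth_lyapunov:
  fixes T :: nat
  assumes "T \<ge> 1" and halved:
    "\<And>y. y \<in> cball 0 1 \<Longrightarrow> 1 - norm y < r \<Longrightarrow> depth (F T y) \<le> depth y / 2"
  shows "\<exists>(V :: real^'n \<Rightarrow> real) C. C \<ge> 1 \<and> (\<forall>y\<in>cball 0 1.
    depth y \<le> V y \<and> V y \<le> C * depth y \<and>
    (\<forall>z\<in>cball 0 1. \<bar>V y - V z\<bar> \<le> C * norm (y - z)) \<and>
    (1 - norm y < r \<longrightarrow> V (F 1 y) \<le> V y - depth y / 2))"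
proof -
  define V where "V y = (\<Sum>j<T. depth (F (real j) y))" for y
  define C where "C = (\<Sum>j<T. 2 * exp (L * real j))"
  have split: "(\<Sum>j<T. f j) = f 0 + (\<Sum>j\<in>{1..<T}. f j)" for f :: "nat \<Rightarrow> real"
    using \<open>T \<ge> 1\<close> by (simp add: lessThan_atLeast0 sum.atLeast_Suc_lessThan)
  have C: "C \<ge> 1"
    unfolding C_def split by (simp add: add_increasing2 sum_nonneg)
  have 1: "depth y \<le> V y" if y: "y \<in> cball 0 1" for y
    unfolding V_def split using flow_0[OF y] depth_nonneg[OF flow_cball[OF y]]
    by (simp add: sum_nonneg)
  have 2: "V y \<le> C * depth y" if y: "y \<in> cball 0 1" for y
    unfolding V_def C_def sum_distrib_right
    using depth_flow_le[OF y] by (intro sum_mono) (metis abs_of_nat)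
  have 3: "\<bar>V y - V z\<bar> \<le> C * norm (y - z)" if y: "y \<in> cball 0 1" and z: "z \<in> cball 0 1" for y z
  proof -
    have "\<bar>V y - V z\<bar> \<le> (\<Sum>j<T. \<bar>depth (F (real j) y) - depth (F (real j) z)\<bar>)"
      unfolding V_def sum_subtractf[symmetric] by (rule sum_abs)
    also have "\<dots> \<le> (\<Sum>j<T. 2 * exp (L * real j) * norm (y - z))"
    proof (intro sum_mono)
      fix j
      show "\<bar>depth (F (real j) y) - depth (F (real j) z)\<bar> \<le> 2 * exp (L * real j) * norm (y - z)"
        using depth_lipschitz[OF flow_cball[OF y] flow_cball[OF z], of "real j" "real j"]
          lipschitz[OF y z, of "real j"] by simp
    qed
    finally show ?thesis by (simp add: C_def sum_distrib_right)
  qed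
  have 4: "V (F 1 y) \<le> V y - depth y / 2" if y: "y \<in> cball 0 1" and near: "1 - norm y < r" for y
  proof -
    have "V (F 1 y) = (\<Sum>j<T. depth (F (real (Suc j)) y))"
      unfolding V_def
      by (intro sum.cong refl) (simp add: flow_add[OF y, symmetric] add.commute)
    also have "\<dots> = (\<Sum>j<Suc T. depth (F (real j) y)) - depth (F 0 y)"
      by (simp only: sum.lessThan_Suc_shift) simp
    also have "\<dots> = V y + depth (F T y) - depth y"
      using flow_0[OF y] by (simp add: V_def)
    finally show ?thesis using halved[OF y near] by simp
  qed
  from C 1 2 3 4 show ?thesis by (intro exI[of _ V] exI[of _ C]) blast
qed

section \<open>Shadowing in the ball\<close>

text \<open>A telescoping estimate: going back from \<open>k + 1\<close> to \<open>k\<close> multiplies the accumulated error by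
\<open>exp L\<close>, but the bound \<open>v (k + 1) ^ N\<close> for it is smaller than \<open>v k ^ N\<close> by \<open>\<theta> ^ N\<close>, which wins. So the
bound does not depend on how far in the future one starts. The weights are only controlled from
\<open>k = 1\<close> on, because a pseudotrajectory is not tested at time zero.\<close>

lemma backward_shadowing:
  fixes y :: "nat \<Rightarrow> real^'n" and v :: "nat \<Rightarrow> real"
  assumes y: "\<And>k. y k \<in> cball 0 1"
    and v: "\<And>k. k \<ge> 1 \<Longrightarrow> 0 \<le> v k" "\<And>k. k \<ge> 1 \<Longrightarrow> v (Suc k) \<le> \<theta> * v k"
    and \<theta>: "0 \<le> \<theta>" "\<theta> \<le> 1" "exp L * \<theta> ^ N \<le> 1 / 2"
    and "\<eta> \<ge> 0"
    and error: "\<And>k. k \<ge> 1 \<Longrightarrow> norm (F (- 1) (y (Suc k)) - y k) \<le> \<eta> * v (Suc k) ^ N"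
  obtains q where "q \<in> cball 0 1" "\<And>k::nat. k \<ge> (1::nat) \<Longrightarrow> norm (F k q - y k) \<le> 2 * \<eta> * v k ^ N"
proof -
  have finite: "norm (F (- real i) (y (k + i)) - y k) \<le> 2 * \<eta> * v k ^ N" if "k \<ge> 1" for k i
    using that
  proof (induction i arbitrary: k)
    case 0
    then show ?case using flow_0[OF y] v(1) \<open>\<eta> \<ge> 0\<close> by simp
  next
    case (Suc i)
    let ?z = "F (- real i) (y (Suc k + i))"
    have z: "?z \<in> cball 0 1" by (intro flow_cball y)
    have v': "v (Suc k) ^ N \<le> \<theta> ^ N * v k ^ N"
      using v(1)[of "Suc k"] v(2)[of k] Suc.prems by (simp add: power_mono flip: power_mult_distrib)
    have "F (- real (Suc i)) (y (k + Suc i)) = F (- 1) ?z"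
      using flow_add[OF y, of "-1" "- real i"] by simp
    then have "norm (F (- real (Suc i)) (y (k + Suc i)) - y k)
        \<le> norm (F (- 1) ?z - F (- 1) (y (Suc k))) + norm (F (- 1) (y (Suc k)) - y k)"
      using norm_triangle_ineq[of "F (- 1) ?z - F (- 1) (y (Suc k))" "F (- 1) (y (Suc k)) - y k"]
      by simp
    also have "\<dots> \<le> exp L * norm (?z - y (Suc k)) + \<eta> * v (Suc k) ^ N"
      using lipschitz[OF z y, of "-1"] error Suc.prems by (intro add_mono) auto
    also have "\<dots> \<le> exp L * (2 * \<eta> * v (Suc k) ^ N) + \<eta> * v (Suc k) ^ N"
      using Suc.IH[of "Suc k"] by simp
    also have "\<dots> = (2 * exp L + 1) * \<eta> * v (Suc k) ^ N" by (simp add: algebra_simps)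
    also have "\<dots> \<le> (2 * exp L + 1) * \<eta> * (\<theta> ^ N * v k ^ N)"
      using v' \<open>\<eta> \<ge> 0\<close> by (intro mult_left_mono) (auto simp: add_nonneg_nonneg)
    also have "\<dots> = (2 * (exp L * \<theta> ^ N) + \<theta> ^ N) * (\<eta> * v k ^ N)" by (simp add: algebra_simps)
    also have "\<dots> \<le> (2 * (1 / 2) + 1) * (\<eta> * v k ^ N)"
      using \<theta> v(1)[OF Suc.prems] \<open>\<eta> \<ge> 0\<close> 
      by (intro mult_right_mono add_mono mult_left_mono power_le_one) auto
    finally show ?case by simp
  qed
  have "\<And>i. F (- real i) (y i) \<in> cball 0 1" by (intro flow_cball y)
  then obtain q r where q: "q \<in> cball 0 1" "strict_mono r"
      "((\<lambda>i. F (- real i) (y i)) \<circ> r) \<longlonglongrightarrow> q"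
    using compact_cball[of "0::real^'n" 1] unfolding compact_def by meson
  have "norm (F k q - y k) \<le> 2 * \<eta> * v k ^ N" if "k \<ge> 1" for k :: nat
  proof -
    have "continuous_on (cball 0 1) (\<lambda>x. (\<lambda>(t, x). F t x) (real k, x))"
      by (rule continuous_on_compose2[OF flow[unfolded flow_on_def, THEN conjunct1]])
        (auto intro!: continuous_intros)
    then have "continuous_on (cball 0 1) (F k)" by simp
    then have "(\<lambda>i. F k (F (- real (r i)) (y (r i)))) \<longlonglongrightarrow> F k q"
      using continuous_on_tendsto_compose[OF _ q(3) q(1), of "F k"] flow_cball[OF y] by simp
    moreover have "\<forall>\<^sub>F i in sequentially. norm (F k (F (- real (r i)) (y (r i))) - y k) \<le> 2 * \<eta> * v k ^ N"
      using eventually_ge_at_top[of k]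
    proof eventually_elim
      case (elim i)
      then have le: "k \<le> r i" using seq_suble[OF q(2), of i] by simp
      have "F k (F (- real (r i)) (y (r i))) = F (- real (r i - k)) (y (k + (r i - k)))"
        using le flow_add[OF y, of "real k" "- real (r i)" "r i"] by (simp add: of_nat_diff)
      with finite[OF that, of "r i - k"] show ?case by simp
    qed
    ultimately show ?thesis
      by (intro tendsto_upperbound[of "\<lambda>i. norm (F k (F (- real (r i)) (y (r i))) - y k)"])
        (auto intro!: tendsto_intros)
  qed
  with q(1) show thesis by (rule that)
qed

end

section \<open>Shadowing near infinity\<close>

lemma powr_minus_double:
  fixes a :: real and N :: nat
  assumes "a > 0"
  shows "a powr (- real (2 * N)) = inverse (a\<^sup>2) ^ N"
  unfolding powr_minus powr_realpow[OF assms] power_mult power_inverse ..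

lemma powr_le_depth_power:
  fixes N :: nat
  assumes "1 \<le> norm x" "2 * real N \<le> n"
  shows "norm x powr (- n) \<le> (2 * depth (Theta x)) ^ N"
proof -
  have "norm x powr (- n) \<le> norm x powr (- real (2 * N))"
    using assms by (intro powr_mono) auto
  also have "\<dots> = inverse ((norm x)\<^sup>2) ^ N"
    using assms(1) by (intro powr_minus_double) linarith
  also have "\<dots> \<le> (2 * depth (Theta x)) ^ N"
  proof (rule power_mono)
    have "1 \<le> (norm x)\<^sup>2" using assms by simp
    then have "2 / (2 * (norm x)\<^sup>2) \<le> 2 / (1 + (norm x)\<^sup>2)"
      by (intro frac_le) (auto simp: add_pos_nonneg)
    then show "inverse ((norm x)\<^sup>2) \<le> 2 * depth (Theta x)"
      by (simp add: depth_Theta inverse_eq_divide)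
  qed simp
  finally show ?thesis .
qed

lemma depth_power_le_powr:
  fixes M :: nat
  assumes "depth (Theta x) \<le> 1 / 2" "\<bar>e\<bar> \<le> 2 * real M"
  shows "depth (Theta x) ^ M \<le> norm x powr e"
proof -
  have "1 + (norm x)\<^sup>2 > 0" by (simp add: add_pos_nonneg)
  then have "1 \<le> (norm x)\<^sup>2" using assms(1) by (simp add: depth_Theta field_simps)
  then have x: "1 \<le> norm x" using power2_le_imp_le[of 1 "norm x"] by simp
  have "depth (Theta x) ^ M \<le> inverse ((norm x)\<^sup>2) ^ M"
    using \<open>1 \<le> (norm x)\<^sup>2\<close> unfolding depth_Theta inverse_eq_divide
    by (intro power_mono frac_le) auto
  also have "\<dots> = norm x powr (- real (2 * M))"
    using x by (intro powr_minus_double[symmetric]) linarith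
  also have "\<dots> \<le> norm x powr e"
    using assms x by (intro powr_mono) auto
  finally show ?thesis .
qed

text \<open>For a flow \<open>H\<close> that already has the right parametrization, the next definitions give a shadowing
property that implies the required one: the errors are compared with the size \<open>d (\<Psi> t)\<close> at the
base point, not with a minimum, and the allowed distance with its value at the right end of
the time interval, not with a maximum.\<close>

definition pseudo_orbit :: "(real \<Rightarrow> real^'n \<Rightarrow> real^'n) \<Rightarrow> (real^'n \<Rightarrow> real) \<Rightarrow> (real \<Rightarrow> real^'n) \<Rightarrow> bool" where
  "pseudo_orbit H d \<Psi> \<longleftrightarrow> (\<forall>t>0. \<forall>\<tau>. \<bar>\<tau>\<bar> \<le> 1 \<longrightarrow> norm (\<Psi> (t + \<tau>) - H \<tau> (\<Psi> t)) \<le> d (\<Psi> t))"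

definition shadowed :: "(real \<Rightarrow> real^'n \<Rightarrow> real^'n) \<Rightarrow> (real^'n \<Rightarrow> real) \<Rightarrow> (real \<Rightarrow> real^'n) \<Rightarrow> bool" where
  "shadowed H \<epsilon> \<Psi> \<longleftrightarrow> (\<exists>q. \<forall>t\<ge>0. norm (\<Psi> t - H t q) \<le> \<epsilon> (H (of_int \<lfloor>t\<rfloor> + 1) q))"

definition flow_shadowing :: "(real \<Rightarrow> real^'n \<Rightarrow> real^'n) \<Rightarrow> (real^'n) set \<Rightarrow> real \<Rightarrow> bool" where
  "flow_shadowing H U e \<longleftrightarrow>
    (\<forall>\<Delta>>0. \<exists>\<delta>\<^sub>0>0. \<exists>n\<^sub>0::real. \<forall>\<delta> n \<Psi>.
       0 < \<delta> \<longrightarrow> \<delta> \<le> \<delta>\<^sub>0 \<longrightarrow> n\<^sub>0 \<le> n \<longrightarrow> (\<forall>t\<ge>0. \<Psi> t \<in> U) \<longrightarrow>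
       pseudo_orbit H (\<lambda>x. \<delta> * norm x powr (- n)) \<Psi> \<longrightarrow> shadowed H (\<lambda>x. \<Delta> * norm x powr e) \<Psi>)"

context ball_flow
begin

text \<open>The exponent \<open>N\<close> is chosen so large that backward expansion is beaten and that two powers of the
depth, lost on the way back by \<open>Xi_lipschitz\<close>, still leave the \<open>M\<close>-th power needed for the
exponent \<open>e\<close>. Only then is \<open>\<delta>\<^sub>0\<close> chosen: its three bounds keep \<open>V\<close> decreasing along \<open>\<Psi>\<close>, keep the
depths of \<open>\<Psi>\<close> and of the shadowing trajectory comparable, and make the final error smaller
than \<open>\<Delta>\<close>. Between \<open>k - 1\<close> and \<open>k\<close> the trajectories are compared backwards from the time \<open>k\<close>, because
this also reaches the times from \<open>0\<close> to \<open>1\<close>, and the pseudotrajectory condition holds at positive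
times only.\<close>

lemma shadowing_near_infinity:
  fixes T :: nat
  assumes "T \<ge> 1" "r > 0" and halved:
    "\<And>y. y \<in> cball 0 1 \<Longrightarrow> 1 - norm y < r \<Longrightarrow> depth (F T y) \<le> depth y / 2"
  shows "\<exists>R. \<forall>U e. U \<subseteq> {x. R \<le> norm x} \<longrightarrow> flow_shadowing G U e"
proof -
  obtain V C where C: "C \<ge> 1" and V: "\<forall>y\<in>cball 0 1.
    depth y \<le> V y \<and> V y \<le> C * depth y \<and>
    (\<forall>z\<in>cball 0 1. \<bar>V y - V z\<bar> \<le> C * norm (y - z)) \<and>
    (1 - norm y < r \<longrightarrow> V (F 1 y) \<le> V y - depth y / 2)"
    using depth_lyapunov[OF \<open>T \<ge> 1\<close> halved] by blast
  have depth_V: "depth y \<le> V y" and V_depth: "V y \<le> C * depth y" if "y \<in> cball 0 1" for y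
    using V that by blast+
  have V_lip: "\<bar>V y - V z\<bar> \<le> C * norm (y - z)" if "y \<in> cball 0 1" "z \<in> cball 0 1" for y z
    using V that by blast
  have V_decr: "V (F 1 y) \<le> V y - depth y / 2" if "y \<in> cball 0 1" "1 - norm y < r" for y
    using V that by blast
  define E where "E = exp L"
  have E: "E \<ge> 1" using L_nonneg by (simp add: E_def)
  \<comment> \<open>\<open>V\<close> decreases by \<open>depth / 2\<close> under the flow; half of this absorbs the error, and \<open>depth \<ge> V / C\<close>\<close>
  define \<theta> where "\<theta> = 1 - 1 / (4 * C)"
  have \<theta>: "0 \<le> \<theta>" "\<theta> < 1" using C by (auto simp: \<theta>_def field_simps)
  define R where "R = max 2 (1 / r)"
  have R: "R \<ge> 2" "1 / R \<le> r" using \<open>r > 0\<close> by (auto simp: R_def field_simps max_def)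
  show ?thesis
  proof (rule exI[of _ R], intro allI impI)
    fix U :: "(real^'n) set" and e :: real
    assume U: "U \<subseteq> {x. R \<le> norm x}"
    show "flow_shadowing G U e" unfolding flow_shadowing_def
    proof (intro allI impI)
      fix \<Delta> :: real
      assume "\<Delta> > 0"
      obtain M :: nat where M: "\<bar>e\<bar> \<le> 2 * real M"
        using real_arch_simple[of "\<bar>e\<bar> / 2"] by (auto simp: field_simps)
      obtain N1 where N1: "\<theta> ^ N1 < 1 / (2 * E)"
        using real_arch_pow_inv[OF _ \<theta>(2), of "1 / (2 * E)"] E by auto
      define N' where "N' = max M N1"
      define N where "N = N' + 2"
      have "\<theta> ^ N \<le> \<theta> ^ N1" using \<theta> by (intro power_decreasing) (auto simp: N_def N'_def)
      then have "\<theta> ^ N \<le> 1 / (2 * E)" using N1 by simp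
      then have \<theta>N: "E * \<theta> ^ N \<le> 1 / 2" using E by (simp add: pos_le_divide_eq mult_ac)
      define A where "A = 4 * (2 * C) ^ N"
      define B where "B = 2 ^ N + 32 * E ^ 3 * A"
      have A: "A > 0" using C by (simp add: A_def)
      have B: "B > 0" using A E by (simp add: B_def add_pos_pos)
      define \<delta>\<^sub>0 where "\<delta>\<^sub>0 = Min {1 / (16 * C), 1 / (8 * E\<^sup>2 * A), \<Delta> / (B * (4 * E) ^ M)}"
      have \<delta>\<^sub>0_le: "\<delta>\<^sub>0 \<le> 1 / (16 * C)" "\<delta>\<^sub>0 \<le> 1 / (8 * E\<^sup>2 * A)" "\<delta>\<^sub>0 \<le> \<Delta> / (B * (4 * E) ^ M)"
        unfolding \<delta>\<^sub>0_def by (rule Min_le; simp)+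
      have "\<delta>\<^sub>0 > 0" using C E A B \<open>\<Delta> > 0\<close> by (auto simp: \<delta>\<^sub>0_def)
      have \<delta>\<^sub>0: "16 * C * \<delta>\<^sub>0 \<le> 1" "8 * E\<^sup>2 * (\<delta>\<^sub>0 * A) \<le> 1" "\<delta>\<^sub>0 * B * (4 * E) ^ M \<le> \<Delta>"
        using \<delta>\<^sub>0_le C E A B by (auto simp: pos_le_divide_eq mult_ac)
      have "shadowed G (\<lambda>x. \<Delta> * norm x powr e) \<Psi>"
        if \<delta>: "0 < \<delta>" "\<delta> \<le> \<delta>\<^sub>0" "2 * real N \<le> n" and in_U: "\<forall>t\<ge>0. \<Psi> t \<in> U"
          and ps: "pseudo_orbit G (\<lambda>x. \<delta> * norm x powr (- n)) \<Psi>"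
        for \<delta> n \<Psi>
      proof -
        have far: "R \<le> norm (\<Psi> t)" if "t \<ge> 0" for t
          using U in_U that by blast
        have pseudo: "norm (\<Psi> (t + \<tau>) - G \<tau> (\<Psi> t)) \<le> \<delta> * norm (\<Psi> t) powr (- n)"
          if "t > 0" "\<bar>\<tau>\<bar> \<le> 1" for t \<tau>
          using ps that unfolding pseudo_orbit_def by blast
        define y where "y t = Theta (\<Psi> t)" for t
        define h where "h t = depth (y t)" for t
        have y: "y t \<in> cball 0 1" for t unfolding y_def by (rule Theta_in_cball)
        have h_pos: "h t > 0" for t by (simp add: h_def y_def depth_pos_iff norm_Theta_less_1)
        have h_small: "h t \<le> 1 / 4" and y_near: "1 - norm (y t) < r" if "t \<ge> 0" for t
        proof -
          have "2 \<le> norm (\<Psi> t)" "R \<le> norm (\<Psi> t)" using far[OF that] R by auto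
          then have "2\<^sup>2 \<le> (norm (\<Psi> t))\<^sup>2" "R\<^sup>2 \<le> (norm (\<Psi> t))\<^sup>2"
            using R by (intro power_mono; simp)+
          then have le: "1 / (1 + (norm (\<Psi> t))\<^sup>2) \<le> 1 / 4" "1 / (1 + (norm (\<Psi> t))\<^sup>2) \<le> 1 / (1 + R\<^sup>2)"
            using zero_le_power2[of R] by (auto intro!: frac_le simp: add_pos_nonneg simp del: zero_le_power2)
          show "h t \<le> 1 / 4" using le by (simp add: h_def y_def depth_Theta)
          have "1 - norm (y t) \<le> h t"
            using y[of t] by (simp add: h_def depth_def power2_eq_square mult_left_le)
          also have "h t \<le> 1 / (1 + R\<^sup>2)" using le by (simp add: h_def y_def depth_Theta)
          also have "1 / (1 + R\<^sup>2) < 1 / R"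
          proof (rule divide_strict_left_mono)
            show "R < 1 + R\<^sup>2" using self_le_power[of R 2] R by linarith
          qed (use R in \<open>auto intro!: mult_pos_pos add_pos_nonneg\<close>)
          finally show "1 - norm (y t) < r" using R by simp
        qed
        have h_power: "h t ^ N \<le> h t ^ i" if "t \<ge> 0" "i \<le> N" for t i
          using h_small[OF that(1)] h_pos[of t] that by (intro power_decreasing) auto
        have err: "norm (\<Psi> s - G (s - t) (\<Psi> t)) \<le> \<delta>\<^sub>0 * (2 * h t) ^ N"
          if "t > 0" "\<bar>s - t\<bar> \<le> 1" for s t
        proof -
          have "norm (\<Psi> s - G (s - t) (\<Psi> t)) \<le> \<delta> * norm (\<Psi> t) powr (- n)"
            using pseudo[OF that] by simp
          also have "\<dots> \<le> \<delta>\<^sub>0 * (2 * h t) ^ N"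
            using \<delta> far[of t] R that unfolding h_def y_def
            by (intro mult_mono powr_le_depth_power) auto
          finally show ?thesis .
        qed
        have ball_err: "norm (F (s - t) (y t) - y s) \<le> 2 * (\<delta>\<^sub>0 * (2 * h t) ^ N)"
          if "t > 0" "\<bar>s - t\<bar> \<le> 1" for s t
        proof -
          have "norm (F (s - t) (y t) - y s) \<le> 2 * norm (G (s - t) (\<Psi> t) - \<Psi> s)"
            using Theta_lipschitz[of "G (s - t) (\<Psi> t)" "\<Psi> s"] by (simp add: Theta_G y_def)
          with err[OF that] show ?thesis by (simp add: norm_minus_commute)
        qed
        have V_nonneg: "0 \<le> V (y t)" for t
          using depth_V[OF y] depth_nonneg[OF y] by (rule order_trans[rotated])
        have V_step: "V (y (t + 1)) \<le> \<theta> * V (y t)" if "t > 0" for t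
        proof -
          have "(2 * h t) ^ N \<le> 2 * h t"
            using h_small[of t] h_pos[of t] that power_decreasing[of 1 N "2 * h t"]
            by (simp add: N_def)
          then have "C * (2 * (\<delta>\<^sub>0 * (2 * h t) ^ N)) \<le> C * (2 * (\<delta>\<^sub>0 * (2 * h t)))"
            using C \<open>\<delta>\<^sub>0 > 0\<close> by (intro mult_left_mono) auto
          also have "\<dots> = (16 * C * \<delta>\<^sub>0) * (h t / 4)" by simp
          also have "\<dots> \<le> 1 * (h t / 4)"
            using \<delta>\<^sub>0(1) h_pos[of t] by (intro mult_right_mono) auto
          finally have "C * (2 * (\<delta>\<^sub>0 * (2 * h t) ^ N)) \<le> h t / 4" by simp
          moreover have "C * norm (F 1 (y t) - y (t + 1)) \<le> C * (2 * (\<delta>\<^sub>0 * (2 * h t) ^ N))"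
            using ball_err[OF that, of "t + 1"] C by (intro mult_left_mono) auto
          moreover have "V (y (t + 1)) \<le> V (F 1 (y t)) + C * norm (F 1 (y t) - y (t + 1))"
            using V_lip[OF flow_cball[OF y] y, of 1 t "t + 1"] by linarith
          moreover have "V (F 1 (y t)) \<le> V (y t) - h t / 2"
            using V_decr[OF y y_near] that by (simp add: h_def)
          ultimately have "V (y (t + 1)) \<le> V (y t) - h t / 4" by linarith
          moreover have "V (y t) / C \<le> h t"
            using V_depth[OF y, of t] C by (simp add: h_def field_simps)
          then have "V (y t) / C / 4 \<le> h t / 4" by simp
          moreover have "\<theta> * V (y t) = V (y t) - V (y t) / C / 4"
            by (simp add: \<theta>_def left_diff_distrib)
          ultimately show ?thesis by simp
        qed
        obtain q' where q': "q' \<in> cball 0 1"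
          and shadow_V: "\<And>k::nat. k \<ge> (1::nat) \<Longrightarrow>
            norm (F k q' - y k) \<le> 2 * (2 * \<delta>\<^sub>0 * 2 ^ N) * V (y k) ^ N"
        proof (rule backward_shadowing[of "\<lambda>k. y (real k)" "\<lambda>k. V (y (real k))" \<theta> N "2 * \<delta>\<^sub>0 * 2 ^ N"])
          show "V (y (real (Suc k))) \<le> \<theta> * V (y (real k))" if "k \<ge> 1" for k
            using V_step[of "real k"] that by (simp add: add.commute)
          show "norm (F (- 1) (y (real (Suc k))) - y (real k)) \<le> 2 * \<delta>\<^sub>0 * 2 ^ N * V (y (real (Suc k))) ^ N"
            for k
          proof -
            have "norm (F (- 1) (y (real (Suc k))) - y (real k)) \<le> 2 * (\<delta>\<^sub>0 * (2 * h (real (Suc k))) ^ N)"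
              using ball_err[of "real (Suc k)" "real k"] by simp
            also have "\<dots> = 2 * \<delta>\<^sub>0 * 2 ^ N * h (real (Suc k)) ^ N"
              by (simp add: power_mult_distrib)
            also have "\<dots> \<le> 2 * \<delta>\<^sub>0 * 2 ^ N * V (y (real (Suc k))) ^ N"
              using depth_V[OF y] h_pos[of "real (Suc k)"] \<open>\<delta>\<^sub>0 > 0\<close>
              by (intro mult_left_mono power_mono) (auto simp: h_def)
            finally show ?thesis .
          qed
        qed (use y V_nonneg \<theta> \<theta>N \<open>\<delta>\<^sub>0 > 0\<close> in \<open>auto simp: E_def simp del: mem_cball_0\<close>)
        have shadow: "norm (F k q' - y k) \<le> \<delta>\<^sub>0 * A * h k ^ N" if "k \<ge> 1" for k :: nat
        proof -
          have "norm (F k q' - y k) \<le> 2 * (2 * \<delta>\<^sub>0 * 2 ^ N) * V (y k) ^ N"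
            by (rule shadow_V[OF that])
          also have "\<dots> \<le> 2 * (2 * \<delta>\<^sub>0 * 2 ^ N) * (C * h k) ^ N"
            using V_depth[OF y] V_nonneg \<open>\<delta>\<^sub>0 > 0\<close>
            by (intro mult_left_mono power_mono) (auto simp: h_def)
          finally show ?thesis by (simp add: A_def power_mult_distrib mult_ac)
        qed
        \<comment> \<open>between integer times the orbit of \<open>q'\<close> stays comparably deep\<close>
        have close: "norm (F s (y k) - F (s + k) q') \<le> E * (\<delta>\<^sub>0 * A * h k ^ N)"
          and deep: "h k / (4 * E) \<le> depth (F s (y k))" "h k / (4 * E) \<le> depth (F (s + k) q')"
          if "k \<ge> 1" "- 1 \<le> s" "s \<le> 0" for k :: nat and s
        proof -
          have es: "exp (L * \<bar>s\<bar>) \<le> E"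
            using that L_nonneg mult_left_le[of "\<bar>s\<bar>" L] by (simp add: E_def)
          have "norm (F s (y k) - F s (F k q')) \<le> exp (L * \<bar>s\<bar>) * norm (y k - F k q')"
            by (rule lipschitz[OF y flow_cball[OF q']])
          also have "\<dots> \<le> E * (\<delta>\<^sub>0 * A * h k ^ N)"
            using es E shadow[OF that(1)] by (intro mult_mono) (auto simp: norm_minus_commute)
          finally show close: "norm (F s (y k) - F (s + k) q') \<le> E * (\<delta>\<^sub>0 * A * h k ^ N)"
            by (simp add: flow_add[OF q'])
          have "h k \<le> 2 * exp (L * \<bar>- s\<bar>) * depth (F s (y k))"
            using depth_flow_le[OF flow_cball[OF y], of "- s" s k] flow_add[OF y, of "- s" s k]
              flow_0[OF y, of k] by (simp add: h_def)
          also have "\<dots> \<le> 2 * E * depth (F s (y k))"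
            using es depth_nonneg[OF flow_cball[OF y]] by (intro mult_right_mono) auto
          finally have half: "h k / (2 * E) \<le> depth (F s (y k))"
            using E by (simp add: field_simps)
          then show "h k / (4 * E) \<le> depth (F s (y k))"
            using E h_pos[of k] by (simp add: field_simps)
          have "2 * (E * (\<delta>\<^sub>0 * A * h k ^ N)) \<le> 2 * (E * (\<delta>\<^sub>0 * A * h k))"
            using h_power[of k 1] E A \<open>\<delta>\<^sub>0 > 0\<close> by (intro mult_left_mono) (auto simp: N_def)
          also have "\<dots> = (8 * E\<^sup>2 * (\<delta>\<^sub>0 * A)) * (h k / (4 * E))"
            using E by (simp add: power2_eq_square field_simps)
          also have "\<dots> \<le> 1 * (h k / (4 * E))"
            using \<delta>\<^sub>0(2) h_pos[of k] E by (intro mult_right_mono) auto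
          finally have "2 * (E * (\<delta>\<^sub>0 * A * h k ^ N)) \<le> h k / (4 * E)" by simp
          moreover have "h k / (2 * E) = h k / (4 * E) + h k / (4 * E)" using E by (simp add: field_simps)
          moreover have "\<bar>depth (F s (y k)) - depth (F (s + k) q')\<bar> \<le> 2 * norm (F s (y k) - F (s + k) q')"
            by (intro depth_lipschitz flow_cball y q')
          ultimately show "h k / (4 * E) \<le> depth (F (s + k) q')"
            using half close by linarith
        qed
        have shallow: "depth (F k q') \<le> 1 / 2" if "k \<ge> 1" for k :: nat
        proof -
          have "2 * norm (F k q' - y k) \<le> 2 * (\<delta>\<^sub>0 * A * h k ^ N)" using shadow[OF that] by simp
          also have "\<dots> \<le> 2 * (\<delta>\<^sub>0 * A * h k)"
            using h_power[of k 1] A \<open>\<delta>\<^sub>0 > 0\<close> by (intro mult_left_mono) (auto simp: N_def)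
          also have "\<dots> \<le> 8 * E\<^sup>2 * (\<delta>\<^sub>0 * A) * h k"
          proof -
            have "1 \<le> 4 * E\<^sup>2" using one_le_power[OF E, of 2] by linarith
            then have "2 * (\<delta>\<^sub>0 * A * h k) * 1 \<le> 2 * (\<delta>\<^sub>0 * A * h k) * (4 * E\<^sup>2)"
              by (rule mult_left_mono) (use A \<open>\<delta>\<^sub>0 > 0\<close> h_pos[of k] in simp)
            then show ?thesis by (simp add: mult_ac)
          qed
          also have "\<dots> \<le> 1 * h k"
            using \<delta>\<^sub>0(2) h_pos[of k] by (intro mult_right_mono) auto
          finally have "2 * norm (F k q' - y k) \<le> h k" by simp
          moreover have "\<bar>depth (F k q') - depth (y k)\<bar> \<le> 2 * norm (F k q' - y k)"
            by (intro depth_lipschitz flow_cball y q')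
          ultimately have "depth (F k q') \<le> 2 * h k" by (simp add: h_def)
          then show ?thesis using h_small[of k] by simp
        qed
        define q where "q = Xi q'"
        have "0 < h 1 / (4 * E)" using h_pos E by simp
        also have "\<dots> \<le> depth (F 1 q')" using deep(2)[of 1 0] by simp
        finally have "norm (F 1 q') < 1" by (simp add: depth_pos_iff)
        then have "norm (F (- 1) (F 1 q')) < 1" by (rule flow_ball)
        then have "norm q' < 1" using flow_add[OF q', of "- 1" 1] flow_0[OF q'] by simp
        then have Theta_q: "Theta q = q'" by (simp add: q_def Theta_Xi)
        have "norm (\<Psi> t - G t q) \<le> \<Delta> * norm (G (of_int \<lfloor>t\<rfloor> + 1) q) powr e" if "t \<ge> 0" for t
        proof -
          define k where "k = Suc (nat \<lfloor>t\<rfloor>)"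
          define s where "s = t - real k"
          have k: "k \<ge> 1" "real k = of_int \<lfloor>t\<rfloor> + 1" using that by (auto simp: k_def)
          have s: "- 1 \<le> s" "s \<le> 0" "s + real k = t" by (auto simp: s_def k(2))
          define D where "D = E * (\<delta>\<^sub>0 * A * h k ^ N)"
          have "norm (\<Psi> t - G t q) \<le> norm (\<Psi> t - G s (\<Psi> k)) + norm (G s (\<Psi> k) - G t q)"
            using norm_triangle_ineq[of "\<Psi> t - G s (\<Psi> k)" "G s (\<Psi> k) - G t q"] by simp
          also have "norm (\<Psi> t - G s (\<Psi> k)) \<le> \<delta>\<^sub>0 * (2 * h k) ^ N"
            using err[of k t] s k(1) by (auto simp: s_def)
          also have "\<dots> = \<delta>\<^sub>0 * 2 ^ N * h k ^ N"
            by (simp add: power_mult_distrib)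
          also have "\<dots> \<le> \<delta>\<^sub>0 * 2 ^ N * h k ^ N'"
            using h_power[of k N'] \<open>\<delta>\<^sub>0 > 0\<close> by (intro mult_left_mono) (auto simp: N_def)
          also have "norm (G s (\<Psi> k) - G t q) \<le> 2 * norm (F s (y k) - F (s + k) q') / (h k / (4 * E))\<^sup>2"
            unfolding G_def Theta_q y_def[symmetric] s(3)
            using deep[OF k(1) s(1,2)] h_pos[of k] E s(3) by (intro Xi_lipschitz) auto
          also have "\<dots> \<le> 2 * D / (h k / (4 * E))\<^sup>2"
            using close[OF k(1) s(1,2)] by (intro divide_right_mono) (auto simp: D_def)
          also have "\<dots> = 32 * E ^ 3 * \<delta>\<^sub>0 * A * h k ^ N'"
            using E h_pos[of k]
            by (simp add: D_def N_def power_add power_divide power_mult_distrib power2_eq_square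
                power3_eq_cube field_simps)
          finally have "norm (\<Psi> t - G t q) \<le> \<delta>\<^sub>0 * B * h k ^ N'"
            by (simp add: B_def algebra_simps)
          also have "\<dots> \<le> \<delta>\<^sub>0 * B * h k ^ M"
            using \<open>\<delta>\<^sub>0 > 0\<close> B h_small[of k] h_pos[of k]
            by (intro mult_left_mono power_decreasing) (auto simp: N'_def)
          also have "\<dots> = (\<delta>\<^sub>0 * B * (4 * E) ^ M) * (h k / (4 * E)) ^ M"
            using E by (simp add: power_divide)
          also have "\<dots> \<le> \<Delta> * depth (Theta (G k q)) ^ M"
            using \<delta>\<^sub>0(3) deep(2)[OF k(1), of 0] h_pos[of k] E \<open>\<Delta> > 0\<close>
            by (intro mult_mono power_mono) (auto simp: Theta_G Theta_q)
          also have "\<dots> \<le> \<Delta> * norm (G k q) powr e"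
            using shallow[OF k(1)] M \<open>\<Delta> > 0\<close>
            by (intro mult_left_mono depth_power_le_powr) (auto simp: Theta_G Theta_q)
          finally show ?thesis by (simp add: k(2))
        qed
        then show ?thesis unfolding shadowed_def by blast
      qed
      with \<open>\<delta>\<^sub>0 > 0\<close> show "\<exists>\<delta>\<^sub>0>0. \<exists>n\<^sub>0::real. \<forall>\<delta> n \<Psi>.
          0 < \<delta> \<longrightarrow> \<delta> \<le> \<delta>\<^sub>0 \<longrightarrow> n\<^sub>0 \<le> n \<longrightarrow> (\<forall>t\<ge>0. \<Psi> t \<in> U) \<longrightarrow>
          pseudo_orbit G (\<lambda>x. \<delta> * norm x powr (- n)) \<Psi> \<longrightarrow> shadowed G (\<lambda>x. \<Delta> * norm x powr e) \<Psi>"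
        by blast
    qed
  qed
qed

end

lemma nonuniform_oriented_shadowingI:
  fixes \<Phi> :: "real \<Rightarrow> real^'n \<Rightarrow> real^'n"
  assumes \<alpha>: "time_change \<Phi> \<alpha>" and H: "\<And>t x. \<Phi> (\<alpha> t x) x = H t x"
    and shadowing: "flow_shadowing H U e"
  shows "nonuniform_oriented_shadowing \<Phi> U e"
  unfolding nonuniform_oriented_shadowing_def
proof (rule exI[of _ \<alpha>], rule conjI[OF \<alpha>], intro allI impI)
  fix \<Delta> :: real
  assume "\<Delta> > 0"
  from shadowing[unfolded flow_shadowing_def, THEN spec, THEN mp, OF this]
  obtain \<delta>\<^sub>0 n\<^sub>0 where "\<delta>\<^sub>0 > 0" and shadow: "\<forall>\<delta> n \<Psi>.
       0 < \<delta> \<longrightarrow> \<delta> \<le> \<delta>\<^sub>0 \<longrightarrow> n\<^sub>0 \<le> n \<longrightarrow> (\<forall>t\<ge>0. \<Psi> t \<in> U) \<longrightarrow>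
       pseudo_orbit H (\<lambda>x. \<delta> * norm x powr (- n)) \<Psi> \<longrightarrow> shadowed H (\<lambda>x. \<Delta> * norm x powr e) \<Psi>"
    by (elim exE conjE)
  let ?d = "\<lambda>\<delta> n x. INF \<tau>\<in>{-1..1}. ereal (\<delta> * norm (\<Phi> (\<alpha> \<tau> x) x) powr (- n))"
  let ?\<epsilon> = "\<lambda>t q. SUP \<tau>\<in>{\<alpha> (of_int \<lfloor>t\<rfloor>) q..\<alpha> (of_int \<lfloor>t\<rfloor> + 1) q}. ereal (\<Delta> * norm (\<Phi> \<tau> q) powr e)"
  have main: "\<exists>q. \<forall>t\<ge>0. ereal (norm (\<Psi> t - \<Phi> (\<alpha> t q) q)) \<le> ?\<epsilon> t q"
    if \<delta>: "0 < \<delta>" "\<delta> \<le> \<delta>\<^sub>0" "n\<^sub>0 \<le> n" and in_U: "\<forall>t\<ge>0. \<Psi> t \<in> U"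
      and ps: "\<forall>t>0. (SUP \<tau>\<in>{-1..1}. ereal (norm (\<Psi> (t + \<tau>) - \<Phi> (\<alpha> \<tau> (\<Psi> t)) (\<Psi> t)))) \<le> ?d \<delta> n (\<Psi> t)"
    for \<delta> n \<Psi>
  proof -
    have start: "H 0 x = x" for x
      using \<alpha> by (auto simp: time_change_def flow_on_def H[symmetric])
    have "norm (\<Psi> (t + \<tau>) - H \<tau> (\<Psi> t)) \<le> \<delta> * norm (\<Psi> t) powr (- n)"
      if "t > 0" "\<bar>\<tau>\<bar> \<le> 1" for t \<tau>
    proof -
      have "ereal (norm (\<Psi> (t + \<tau>) - \<Phi> (\<alpha> \<tau> (\<Psi> t)) (\<Psi> t)))
          \<le> (SUP \<tau>\<in>{-1..1}. ereal (norm (\<Psi> (t + \<tau>) - \<Phi> (\<alpha> \<tau> (\<Psi> t)) (\<Psi> t))))"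
        using that(2) by (intro SUP_upper) (simp add: abs_le_iff)
      also have "\<dots> \<le> ?d \<delta> n (\<Psi> t)"
        using ps that(1) by simp
      also have "\<dots> \<le> ereal (\<delta> * norm (\<Phi> (\<alpha> 0 (\<Psi> t)) (\<Psi> t)) powr (- n))"
        by (rule INF_lower) simp
      finally show ?thesis by (simp add: H start)
    qed
    then have "pseudo_orbit H (\<lambda>x. \<delta> * norm x powr (- n)) \<Psi>"
      by (simp add: pseudo_orbit_def)
    then have "shadowed H (\<lambda>x. \<Delta> * norm x powr e) \<Psi>"
      using shadow \<delta> in_U by simp
    then obtain q where q: "\<forall>t\<ge>0. norm (\<Psi> t - H t q) \<le> \<Delta> * norm (H (of_int \<lfloor>t\<rfloor> + 1) q) powr e"
      unfolding shadowed_def ..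
    have mono: "strict_mono (\<lambda>t. \<alpha> t q)" using \<alpha> by (simp add: time_change_def Rep_def)
    show ?thesis
    proof (rule exI[of _ q], intro allI impI)
      fix t :: real
      assume "t \<ge> 0"
      have "ereal (norm (\<Psi> t - \<Phi> (\<alpha> t q) q))
          \<le> ereal (\<Delta> * norm (\<Phi> (\<alpha> (of_int \<lfloor>t\<rfloor> + 1) q) q) powr e)"
        using q \<open>t \<ge> 0\<close> by (simp add: H)
      also have "\<dots> \<le> ?\<epsilon> t q"
        using strict_mono_less_eq[OF mono, of "of_int \<lfloor>t\<rfloor>" "of_int \<lfloor>t\<rfloor> + 1"]
        by (intro SUP_upper) simp
      finally show "ereal (norm (\<Psi> t - \<Phi> (\<alpha> t q) q)) \<le> ?\<epsilon> t q" .
    qed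
  qed
  show "\<exists>\<delta>\<^sub>0>0. \<exists>n\<^sub>0::real. \<forall>\<delta> n. 0 < \<delta> \<and> \<delta> \<le> \<delta>\<^sub>0 \<and> n\<^sub>0 \<le> n \<longrightarrow>
      (\<forall>\<Psi> :: real \<Rightarrow> real^'n. (\<forall>t\<ge>0. \<Psi> t \<in> U) \<and>
        (\<forall>t>0. (SUP \<tau>\<in>{-1..1}. ereal (norm (\<Psi> (t + \<tau>) - \<Phi> (\<alpha> \<tau> (\<Psi> t)) (\<Psi> t)))) \<le> ?d \<delta> n (\<Psi> t)) \<longrightarrow>
        (\<exists>q. \<forall>t\<ge>0. ereal (norm (\<Psi> t - \<Phi> (\<alpha> t q) q)) \<le> ?\<epsilon> t q))"
    by (rule exI[of _ \<delta>\<^sub>0], rule conjI[OF \<open>\<delta>\<^sub>0 > 0\<close>], rule exI[of _ n\<^sub>0], intro allI impI,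
        elim conjE) (rule main)
qed

text \<open>One neighbourhood of infinity serves all exponents at once, so it can be fixed before \<open>m\<close> is given.\<close>

lemma contracting_sphere_shadowing:
  fixes X :: "real^'n \<Rightarrow> real^'n"
  assumes gen: "generates_flow_on UNIV X \<Phi>"
    and comp: "compactified_flow X F"
    and MA: "main_assumption_0_3 F (sphere 0 1) \<L> \<mu>\<^sub>1 \<mu>\<^sub>2 C\<^sub>0" "\<mu>\<^sub>2 < 0"
  shows "\<exists>R. \<forall>U e. U \<subseteq> {x. R \<le> norm x} \<longrightarrow> nonuniform_oriented_shadowing \<Phi> U e"
proof -
  obtain Y where Y: "compactified_field X Y" "generates_flow_on (cball 0 1) Y F"
    using comp by (auto simp: compactified_flow_def)
  obtain L where L: "L \<ge> 0" "\<forall>t. \<forall>y\<in>cball 0 1. \<forall>z\<in>cball 0 1.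
      norm (F t y - F t z) \<le> exp (L * \<bar>t\<bar>) * norm (y - z)"
    using generated_flow_lipschitz[OF Y(2) compact_cball convex_cball] by blast
  have "F t ` sphere 0 1 = sphere 0 1" for t
    using MA by (auto simp: main_assumption_0_3_def locally_maximal_invariant_def)
  then interpret ball_flow F L
    using L Y(2) by unfold_locales (auto simp: generates_flow_on_def)
  obtain \<alpha> where \<alpha>: "time_change \<Phi> \<alpha>" "\<forall>t x. \<Phi> (\<alpha> t x) x = G t x"
    using compactified_time_change[OF gen Y ball_flow_axioms] by blast
  obtain T :: nat and r where "T \<ge> 1" "r > 0"
    and T: "\<forall>y\<in>cball 0 1. 1 - norm y < r \<longrightarrow> depth (F T y) \<le> depth y / 2"
    using depth_halved_near_boundary[OF MA] by blast
  have "\<exists>R. \<forall>U e. U \<subseteq> {x. R \<le> norm x} \<longrightarrow> flow_shadowing G U e"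
    using T by (intro shadowing_near_infinity[OF \<open>T \<ge> 1\<close> \<open>r > 0\<close>]) blast
  then obtain R where R: "\<forall>U e. U \<subseteq> {x. R \<le> norm x} \<longrightarrow> flow_shadowing G U e" ..
  have "nonuniform_oriented_shadowing \<Phi> U e" if "U \<subseteq> {x. R \<le> norm x}" for U e
  proof (rule nonuniform_oriented_shadowingI[OF \<alpha>(1)])
    show "\<Phi> (\<alpha> t x) x = G t x" for t x using \<alpha>(2) by blast
    show "flow_shadowing G U e" using R that by blast
  qed
  then show ?thesis by blast
qed

theorem theorem10:
  fixes X :: "real^'n \<Rightarrow> real^'n"
    and \<Phi> \<Phi>' :: "real \<Rightarrow> real^'n \<Rightarrow> real^'n"
  assumes "generates_flow_on UNIV X \<Phi>"
    and "normalizable X"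
    and "compactified_flow X \<Phi>'"
  shows "\<exists>U\<^sub>0. neighborhood_of_infinity U\<^sub>0 \<and>
    (\<forall>U. neighborhood_of_infinity U \<and> U \<subseteq> U\<^sub>0 \<longrightarrow>
      (\<forall>\<mu>\<^sub>1 \<mu>\<^sub>2 lsmin m :: real.
         main_assumption_4a \<Phi>' (sphere 0 1) \<mu>\<^sub>1 \<mu>\<^sub>2 lsmin \<and> \<mu>\<^sub>2 < 0 \<and>
         exp (\<mu>\<^sub>2 * m) < exp lsmin \<longrightarrow>
         nonuniform_oriented_shadowing \<Phi> U (3 - 2 * m)) \<and>
      (\<forall>\<mu>\<^sub>1 \<mu>\<^sub>2 lsmin lsmax lumin lumax m :: real.
         main_assumption_4b \<Phi>' (sphere 0 1) \<mu>\<^sub>1 \<mu>\<^sub>2 lsmin lsmax lumin lumax \<and> \<mu>\<^sub>2 < 0 \<and>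
         m \<ge> 0 \<and> exp (\<mu>\<^sub>1 * m) > exp lsmax \<longrightarrow>
         nonuniform_oriented_shadowing \<Phi> U (3 - 2 * m)))"
proof (cases "\<exists>\<L> \<mu>\<^sub>1 \<mu>\<^sub>2 C\<^sub>0. main_assumption_0_3 \<Phi>' (sphere 0 1) \<L> \<mu>\<^sub>1 \<mu>\<^sub>2 C\<^sub>0 \<and> \<mu>\<^sub>2 < 0")
  case True
  then obtain \<L> \<mu>\<^sub>1 \<mu>\<^sub>2 C\<^sub>0 where "main_assumption_0_3 \<Phi>' (sphere 0 1) \<L> \<mu>\<^sub>1 \<mu>\<^sub>2 C\<^sub>0" "\<mu>\<^sub>2 < 0"
    by blast
  from contracting_sphere_shadowing[OF assms(1,3) this]
  obtain R where R: "\<forall>U e. U \<subseteq> {x. R \<le> norm x} \<longrightarrow> nonuniform_oriented_shadowing \<Phi> U e" ..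
  have "neighborhood_of_infinity {x::real^'n. R \<le> norm x}"
    by (auto simp: neighborhood_of_infinity_def eventually_at_infinity)
  with R show ?thesis
    by (intro exI[of _ "{x. R \<le> norm x}"] conjI allI impI) simp_all
next
  case False
  then have no: "\<And>\<L> \<mu>\<^sub>1 \<mu>\<^sub>2 C\<^sub>0. main_assumption_0_3 \<Phi>' (sphere 0 1) \<L> \<mu>\<^sub>1 \<mu>\<^sub>2 C\<^sub>0 \<Longrightarrow> \<not> \<mu>\<^sub>2 < 0"
    by blast
  have "\<not> main_assumption_4a \<Phi>' (sphere 0 1) \<mu>\<^sub>1 \<mu>\<^sub>2 lsmin"
    and "\<mu>\<^sub>2 < 0 \<Longrightarrow> \<not> main_assumption_4b \<Phi>' (sphere 0 1) \<mu>\<^sub>1 \<mu>\<^sub>2 lsmin lsmax lumin lumax"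
    for \<mu>\<^sub>1 \<mu>\<^sub>2 lsmin lsmax lumin lumax
    by (auto simp: main_assumption_4a_def main_assumption_4b_def dest: no)
  then show ?thesis
    by (intro exI[of _ UNIV]) (auto simp: neighborhood_of_infinity_def)
qed

end
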